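(* There is an absolute constant $C>0$ such that for every integer $d\ge 3$ and every graph $G$ of maximum degree at most $d$, $$\vartheta_{\mathrm{SDP}}(G)\;\le\; C\, d\left(\frac{\log\log d}{\log d}\right)^{3/2}\alpha(G).$$ In other words, the integrality gap of the standard Lovász $\vartheta$-function SDP relaxation for maximum independent set on graphs of maximum degree $d$ is $O\big(d(\log\log d/\log d)^{3/2}\big)=\widetilde O(d/\log^{3/2} d)$.
   Context: For a graph $G=(V,E)$ with $V=[n]$, $\alpha(G)$ denotes the maximum size of an independent set. The standard SDP relaxation $\vartheta_{\mathrm{SDP}}(G)$ is the optimum of: maximize $\sum_{i=1}^n v_i\cdot v_0$ over vectors $v_0,v_1,\dots,v_n$ (in some Euclidean space) subject to $v_0\cdot v_0=1$, $v_0\cdot v_i=v_i\cdot v_i$ for all $i\in[n]$, and $v_i\cdot v_j=0$ for every edge $(i,j)\in E$. (Equivalently: maximize $\sum_i y_{0i}$ over positive semidefinite $(n+1)\times(n+1)$ matrices $Y$ with $y_{00}=1$, $y_{0i}=y_{ii}$, and $y_{ij}=0$ for $(i,j)\in E$.) Logarithms are base 2; $\widetilde O(\cdot)$ suppresses $\mathrm{poly}(\log\log d)$ factors. *)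

theory Defs
  imports Complex_Main
begin

text \<open>A simple graph on vertex set [n] = {1..n}, given by an edge relation E.\<close>
definition simple_graph :: "nat \<Rightarrow> (nat \<Rightarrow> nat \<Rightarrow> bool) \<Rightarrow> bool" where
  "simple_graph n E \<longleftrightarrow> (\<forall>i j. E i j \<longrightarrow> E j i) \<and> (\<forall>i. \<not> E i i)"

definition degree :: "nat \<Rightarrow> (nat \<Rightarrow> nat \<Rightarrow> bool) \<Rightarrow> nat \<Rightarrow> nat" where
  "degree n E i = card {j \<in> {1..n}. E i j}"

definition max_degree_le :: "nat \<Rightarrow> (nat \<Rightarrow> nat \<Rightarrow> bool) \<Rightarrow> nat \<Rightarrow> bool" where
  "max_degree_le n E d \<longleftrightarrow> (\<forall>i\<in>{1..n}. degree n E i \<le> d)"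

definition independent_set :: "nat \<Rightarrow> (nat \<Rightarrow> nat \<Rightarrow> bool) \<Rightarrow> nat set \<Rightarrow> bool" where
  "independent_set n E S \<longleftrightarrow> S \<subseteq> {1..n} \<and> (\<forall>i\<in>S. \<forall>j\<in>S. \<not> E i j)"

definition alpha :: "nat \<Rightarrow> (nat \<Rightarrow> nat \<Rightarrow> bool) \<Rightarrow> nat" where
  "alpha n E = Max (card ` {S. independent_set n E S})"

text \<open>Feasibility for the standard SDP, in Gram-matrix form: Y is an (n+1)x(n+1)
  real symmetric positive semidefinite matrix indexed by {0..n} with y00 = 1,
  y0i = yii and yij = 0 for edges ij.\<close>
definition sdp_feasible :: "nat \<Rightarrow> (nat \<Rightarrow> nat \<Rightarrow> bool) \<Rightarrow> (nat \<Rightarrow> nat \<Rightarrow> real) \<Rightarrow> bool" where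
  "sdp_feasible n E Y \<longleftrightarrow>
     (\<forall>i\<in>{0..n}. \<forall>j\<in>{0..n}. Y i j = Y j i) \<and>
     (\<forall>x :: nat \<Rightarrow> real. 0 \<le> (\<Sum>i=0..n. \<Sum>j=0..n. x i * Y i j * x j)) \<and>
     Y 0 0 = 1 \<and>
     (\<forall>i\<in>{1..n}. Y 0 i = Y i i) \<and>
     (\<forall>i\<in>{1..n}. \<forall>j\<in>{1..n}. E i j \<longrightarrow> Y i j = 0)"

definition theta_sdp :: "nat \<Rightarrow> (nat \<Rightarrow> nat \<Rightarrow> bool) \<Rightarrow> real" where
  "theta_sdp n E = Sup {(\<Sum>i=1..n. Y 0 i) | Y. sdp_feasible n E Y}"

end

(* Write l = ln d and x i = Y i i, and split the vertices by the size of x i. Vertices with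
   x i <= 1/l^2 contribute at most n/l^2, and n <= (d + 1) alpha. If x i > b = 3 ln l / l, the SDP
   vectors, projected away from v_0, have inner products at most -b along edges after normalization, so
   Gaussian rounding yields a stable set of at least a (l^(3/2) / d)-fraction of these vertices.
   The remaining vertices contribute at most b each; since the x i over a clique sum to at most 1, their
   cliques have fewer than l^2 vertices, and Shearer's argument with a uniformly random stable set gives
   alpha >= c sqrt (ln d / ln r) / d times their number for K_r-free graphs, here with r about l^2. *)
theory Submission
  imports Defs "HOL-Probability.Probability" "HOL-Real_Asymp.Real_Asymp"
begin

section \<open>Stable sets in graphs without large cliques\<close>

text \<open>With \<open>g = ln l / l\<close>, the target is g^(3/2). The small and large classes
  contribute only order l^(-3/2); the middle class fixes the rate. Rounding gains a factor d^b = exp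
  (b * l) per vertex, so a cutoff \<open>b\<close> of order g is what buys a power of l; the
  constant 3 instead of 2 leaves room for constant factors. The other factor, sqrt g, is Shearer's
  bound with ln r of order ln l; only ln r matters, so any fixed power of 1/l up to l^(-3/2) could
  be the lower cutoff. The square root in Shearer's bound comes from counting. An average stable set
  in any set of x neighbours of v should have about s elements. If x is at least r^O(s), greedy
  choice gives about x^(2 s) / (4 s)^(4 s) stable sets of size 4 s, more than the x^s sets smaller
  than s. If x is less, at most r^O(s^2) sets are smaller than s: either most stable sets are
  larger, or there are so few stable sets that the weight d attached to v pays for all of them.
  Hence the requirement d >= r^O(s^2).\<close>

definition stable_sets :: "('a \<Rightarrow> 'a \<Rightarrow> bool) \<Rightarrow> 'a set \<Rightarrow> 'a set set" where
  "stable_sets E S = {I. I \<subseteq> S \<and> (\<forall>i\<in>I. \<forall>j\<in>I. \<not> E i j)}"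

text \<open>Excluding the exact size \<open>r\<close> excludes larger cliques too, since subsets of
  cliques are cliques.\<close>

definition clique_free :: "('a \<Rightarrow> 'a \<Rightarrow> bool) \<Rightarrow> nat \<Rightarrow> 'a set \<Rightarrow> bool" where
  "clique_free E r S \<longleftrightarrow> (\<forall>Q\<subseteq>S. finite Q \<longrightarrow> pairwise E Q \<longrightarrow> card Q \<noteq> r)"

text \<open>Greedy choices are counted as lists, one factor per chosen vertex; returning to sets
  costs at most \<open>m ^ m\<close> orderings.\<close>

definition stable_tuples :: "('a \<Rightarrow> 'a \<Rightarrow> bool) \<Rightarrow> nat \<Rightarrow> 'a set \<Rightarrow> 'a list set" where
  "stable_tuples E m S = {xs. length xs = m \<and> distinct xs \<and> set xs \<in> stable_sets E S}"

lemma clique_free_mono: "clique_free E r S \<Longrightarrow> T \<subseteq> S \<Longrightarrow> clique_free E r T"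
  unfolding clique_free_def by blast

lemma finite_stable_sets: "finite S \<Longrightarrow> finite (stable_sets E S)"
  unfolding stable_sets_def by (rule finite_subset[of _ "Pow S"]) auto

lemma finite_stable_tuples: "finite S \<Longrightarrow> finite (stable_tuples E m S)"
  by (rule finite_subset[OF _ finite_lists_length_eq[of S m]])
     (auto simp: stable_tuples_def stable_sets_def)

text \<open>A clique grows greedily: fewer than \<open>r\<close> chosen vertices together exclude
  fewer than \<open>card B\<close> vertices, so some vertex of \<open>B\<close> is adjacent to all
  of them. By irreflexivity every chosen vertex is itself excluded, so the vertex found is
  new.\<close>

lemma clique_of_few_nonneighbours:
  assumes fin: "finite B" and sym: "symp E" and irr: "irreflp E" and pos: "B \<noteq> {}"
    and few: "\<And>v. v \<in> B \<Longrightarrow> r * card {u\<in>B. \<not> E v u} < card B"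
  shows "\<not> clique_free E r B"
proof -
  have "\<exists>Q. Q \<subseteq> B \<and> finite Q \<and> card Q = k \<and> pairwise E Q" if "k \<le> r" for k
    using that
  proof (induction k)
    case 0
    then show ?case by (intro exI[of _ "{}"]) auto
  next
    case (Suc k)
    then obtain Q where Q: "Q \<subseteq> B" "finite Q" "card Q = k" "pairwise E Q"
      by auto
    define U where "U = (\<Union>v\<in>Q. {u\<in>B. \<not> E v u})"
    have "r * card U \<le> r * (\<Sum>v\<in>Q. card {u\<in>B. \<not> E v u})"
      unfolding U_def using Q(2) by (intro mult_le_mono2 card_UN_le)
    also have "\<dots> = (\<Sum>v\<in>Q. r * card {u\<in>B. \<not> E v u})"
      by (simp add: sum_distrib_left)
    also have "\<dots> \<le> (\<Sum>v\<in>Q. card B)"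
      using few Q(1) by (intro sum_mono) (auto intro: less_imp_le)
    also have "\<dots> = k * card B" using Q by simp
    also have "\<dots> < r * card B" using Suc.prems pos fin by (simp add: card_gt_0_iff)
    finally have "card U < card B" by simp
    moreover have "U \<subseteq> B" unfolding U_def by auto
    ultimately obtain w where w: "w \<in> B" "w \<notin> U" by (metis subsetI subset_antisym less_irrefl)
    then have adj: "E v w" if "v \<in> Q" for v using that unfolding U_def by auto
    then have "w \<notin> Q" using irr by (auto simp: irreflp_def)
    moreover have "E w v" if "v \<in> Q" for v using adj[OF that] sym by (auto simp: symp_def)
    ultimately show ?case using Q w adj
      by (intro exI[of _ "insert w Q"]) (auto simp: pairwise_insert)
  qed
  then show ?thesis unfolding clique_free_def by blast
qed

text \<open>A vertex \<open>v\<close> may be put in front of any stable tuple of its non-neighbours,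
  and lists with different heads differ. \<open>G\<close> will consist of heads with many
  non-neighbours.\<close>

lemma card_stable_tuples_Suc:
  assumes fin: "finite S" and sym: "symp E" and irr: "irreflp E" and "G \<subseteq> S"
  shows "(\<Sum>v\<in>G. card (stable_tuples E m {u\<in>S. u \<noteq> v \<and> \<not> E v u})) \<le> card (stable_tuples E (Suc m) S)"
proof -
  let ?N = "\<lambda>v. {u\<in>S. u \<noteq> v \<and> \<not> E v u}"
  have finG: "finite G" using assms finite_subset by blast
  have "(\<Sum>v\<in>G. card (stable_tuples E m (?N v))) = (\<Sum>v\<in>G. card (Cons v ` stable_tuples E m (?N v)))"
    by (intro sum.cong refl card_image[symmetric]) (auto simp: inj_on_def)
  also have "\<dots> = card (\<Union>v\<in>G. Cons v ` stable_tuples E m (?N v))"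
    using finG fin by (intro card_UN_disjoint[symmetric]) (auto intro!: finite_imageI finite_stable_tuples)
  also have "\<dots> \<le> card (stable_tuples E (Suc m) S)"
  proof (intro card_mono finite_stable_tuples fin subsetI)
    fix xs assume "xs \<in> (\<Union>v\<in>G. Cons v ` stable_tuples E m (?N v))"
    then obtain v ys where v: "v \<in> G" and xs: "xs = v # ys" and ys: "ys \<in> stable_tuples E m (?N v)"
      by auto
    have "\<not> E v u \<and> \<not> E u v" if "u \<in> set ys" for u
      using that ys sym by (auto simp: stable_tuples_def stable_sets_def symp_def)
    moreover have "\<not> E v v" using irr by (auto simp: irreflp_def)
    moreover have "v \<in> S" using v assms by auto
    ultimately show "xs \<in> stable_tuples E (Suc m) S"
      using ys unfolding xs by (auto simp: stable_tuples_def stable_sets_def)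
  qed
  finally show ?thesis .
qed

text \<open>At least half of the vertices have at least \<open>card S / (2 * r)\<close>
  non-neighbours, for otherwise the remaining ones, forming \<open>B\<close>, would contain a clique
  of size \<open>r\<close>. Each of these at least \<open>y\<close> vertices can be the head, and
  its non-neighbourhood is still large enough for \<open>m\<close> further choices.\<close>

lemma card_stable_tuples_ge:
  assumes "finite S" and sym: "symp E" and irr: "irreflp E" and "clique_free E r S"
    and r: "r > 0" and y: "y > 0" and "2 * y * (4 * r) ^ m \<le> card S"
  shows "y ^ m \<le> card (stable_tuples E m S)"
  using assms(1,4,7)
proof (induction m arbitrary: S)
  case 0
  have "stable_tuples E 0 S = {[]}" by (auto simp: stable_tuples_def stable_sets_def)
  then show ?case by simp
next
  case (Suc m)
  let ?N = "\<lambda>v. {u\<in>S. u \<noteq> v \<and> \<not> E v u}"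
  define B where "B = {v\<in>S. 2 * r * card {u\<in>S. \<not> E v u} < card S}"
  have finB: "finite B" using Suc.prems by (simp add: B_def)
  have BS: "B \<subseteq> S" by (auto simp: B_def)
  have half: "2 * card B \<le> card S"
  proof (rule ccontr)
    assume big: "\<not> ?thesis"
    have "r * card {u\<in>B. \<not> E v u} < card B" if "v \<in> B" for v
    proof -
      have "card {u\<in>B. \<not> E v u} \<le> card {u\<in>S. \<not> E v u}"
        using Suc.prems BS by (intro card_mono) auto
      then have "2 * r * card {u\<in>B. \<not> E v u} \<le> 2 * r * card {u\<in>S. \<not> E v u}" by simp
      also have "\<dots> < card S" using that by (simp add: B_def)
      finally show ?thesis using big by simp
    qed
    moreover have "B \<noteq> {}" using big by auto
    ultimately have "\<not> clique_free E r B"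
      using clique_of_few_nonneighbours[OF finB sym irr] by blast
    then show False using clique_free_mono[OF Suc.prems(2) BS] by simp
  qed
  have step: "y ^ m \<le> card (stable_tuples E m (?N v))" if v: "v \<in> S - B" for v
  proof (rule Suc.IH)
    show "finite (?N v)" using Suc.prems by simp
    show "clique_free E r (?N v)" by (rule clique_free_mono[OF Suc.prems(2)]) auto
    have "{u\<in>S. \<not> E v u} = insert v (?N v)" using v irr by (auto simp: irreflp_def)
    then have c: "card {u\<in>S. \<not> E v u} = Suc (card (?N v))" using Suc.prems by simp
    have "2 * r * (4 * y * (4 * r) ^ m) = 2 * y * (4 * r) ^ Suc m" by simp
    also have "\<dots> \<le> card S" by fact
    also have "\<dots> \<le> 2 * r * Suc (card (?N v))" using v c by (auto simp: B_def)
    finally have "4 * y * (4 * r) ^ m \<le> Suc (card (?N v))"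
      using r by (subst (asm) mult_le_cancel1) auto
    \<comment> \<open>The bound divides by \<open>2 * r\<close> only; the other factor 2 in
      \<open>4 * r\<close> pays for \<open>v\<close>, which counts among its own
      non-neighbours.\<close>
    moreover have "1 \<le> y * (4 * r) ^ m" using y r by simp
    ultimately show "2 * y * (4 * r) ^ m \<le> card (?N v)" by linarith
  qed
  have "y \<le> card (S - B)"
  proof -
    have "1 \<le> (4 * r) ^ Suc m" using r by (simp del: power_Suc)
    then have "2 * y * 1 \<le> 2 * y * (4 * r) ^ Suc m" by (intro mult_le_mono2)
    then have "2 * y \<le> card S" using Suc.prems(3) by linarith
    then show ?thesis using half BS finB by (simp add: card_Diff_subset)
  qed
  then have "y ^ Suc m \<le> (\<Sum>v\<in>S - B. y ^ m)" by simp
  also have "\<dots> \<le> (\<Sum>v\<in>S - B. card (stable_tuples E m (?N v)))" by (intro sum_mono step)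
  also have "\<dots> \<le> card (stable_tuples E (Suc m) S)"
    using Suc.prems by (intro card_stable_tuples_Suc sym irr) auto
  finally show ?case .
qed

lemma card_stable_tuples_le:
  assumes "finite S"
  shows "card (stable_tuples E m S) \<le> m ^ m * card {I \<in> stable_sets E S. card I = m}"
proof -
  let ?J = "{I \<in> stable_sets E S. card I = m}"
  have finJ: "finite ?J" using finite_stable_sets[OF assms] by simp
  have finI: "finite I" if "I \<in> ?J" for I
    using that assms finite_subset by (auto simp: stable_sets_def)
  have "stable_tuples E m S \<subseteq> (\<Union>I\<in>?J. {xs. set xs \<subseteq> I \<and> length xs = m})"
  proof
    fix xs assume "xs \<in> stable_tuples E m S"
    then have "set xs \<in> ?J" "length xs = m" by (auto simp: stable_tuples_def distinct_card)
    then show "xs \<in> (\<Union>I\<in>?J. {xs. set xs \<subseteq> I \<and> length xs = m})" by blast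
  qed
  then have "card (stable_tuples E m S) \<le> card (\<Union>I\<in>?J. {xs. set xs \<subseteq> I \<and> length xs = m})"
    by (rule card_mono[rotated]) (intro finite_UN_I finJ finite_lists_length_eq finI)
  also have "\<dots> \<le> (\<Sum>I\<in>?J. card {xs. set xs \<subseteq> I \<and> length xs = m})"
    using finJ by (rule card_UN_le)
  also have "\<dots> = (\<Sum>I\<in>?J. m ^ m)"
    using finI by (intro sum.cong refl) (subst card_lists_length_eq, auto)
  finally show ?thesis by (simp add: mult.commute)
qed

lemma card_small_subsets_le:
  assumes fin: "finite S" and "card S \<le> X" and "2 \<le> X"
  shows "card {I. I \<subseteq> S \<and> card I < s} \<le> X ^ s"
proof (induction s)
  case 0
  then show ?case by simp
next
  case (Suc s)
  have "card {I. I \<subseteq> S \<and> card I < Suc s} \<le> card ({I. I \<subseteq> S \<and> card I < s} \<union> {I. I \<subseteq> S \<and> card I = s})"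
    using fin by (intro card_mono) auto
  also have "\<dots> \<le> card {I. I \<subseteq> S \<and> card I < s} + card {I. I \<subseteq> S \<and> card I = s}"
    by (rule card_Un_le)
  also have "card {I. I \<subseteq> S \<and> card I = s} = card S choose s" by (rule n_subsets[OF fin])
  also have "card S choose s \<le> X ^ s"
  proof (cases "s \<le> card S")
    case True
    then have "card S choose s \<le> card S ^ s" by (rule binomial_le_pow)
    also have "\<dots> \<le> X ^ s" using assms by (intro power_mono) auto
    finally show ?thesis .
  qed (simp add: binomial_eq_0)
  also have "card {I. I \<subseteq> S \<and> card I < s} + X ^ s \<le> X ^ s + X ^ s" using Suc by simp
  also have "\<dots> = 2 * X ^ s" by simp
  also have "\<dots> \<le> X * X ^ s" using assms(3) by (rule mult_le_mono1)
  finally show ?case by simp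
qed

text \<open>There are at least \<open>(sqrt x / m) ^ m\<close> stable sets of size \<open>m = 4 * s\<close> on \<open>x\<close> vertices, roughly the square
  of the number of all sets of size less than \<open>s\<close>.\<close>

lemma few_small_stable_sets:
  assumes fin: "finite S" and sym: "symp E" and irr: "irreflp E" and cf: "clique_free E r S"
    and s: "0 < s" "s \<le> r" and z: "z = 2 * (4 * r) ^ (4 * s)" and big: "z ^ 2 \<le> card S"
  shows "2 * card {I \<in> stable_sets E S. card I < s} \<le> card (stable_sets E S)"
proof -
  \<comment> \<open>With y about sqrt |S|, the size condition for tuples reads
    \<open>y * z <= card S\<close>, which follows from \<open>z <= y\<close>, and y^(4 s) is about
    |S|^(2 s).\<close>
  define y where "y = nat \<lfloor>sqrt (real (card S))\<rfloor>"
  have y1: "y ^ 2 \<le> card S"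
  proof -
    have "real y \<le> sqrt (real (card S))" by (simp add: y_def)
    then have "real y ^ 2 \<le> sqrt (real (card S)) ^ 2" by (intro power_mono) auto
    then have "real (y ^ 2) \<le> real (card S)" by simp
    then show ?thesis by linarith
  qed
  have "z \<le> y"
  proof -
    have "real z = sqrt (real (z ^ 2))" by simp
    also have "\<dots> \<le> sqrt (real (card S))" using big by (intro real_sqrt_le_mono) (simp only: of_nat_le_iff)
    finally show ?thesis unfolding y_def by linarith
  qed
  have z1: "2 \<le> z" using s by (simp add: z)
  have y2: "card S \<le> 4 * y ^ 2"
  proof -
    have "sqrt (real (card S)) \<le> real y + 1" unfolding y_def by linarith
    also have "\<dots> \<le> 2 * real y" using \<open>z \<le> y\<close> z1 by simp
    finally have "sqrt (real (card S)) ^ 2 \<le> (2 * real y) ^ 2" by (intro power_mono) auto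
    then have "real (card S) \<le> real (4 * y ^ 2)" by (simp add: power_mult_distrib)
    then show ?thesis by linarith
  qed
  have ypos: "0 < y" using \<open>z \<le> y\<close> z1 by simp
  define K where "K = (4 * s) ^ (4 * s)"
  have "2 * y * (4 * r) ^ (4 * s) = y * z" by (simp add: z)
  also have "\<dots> \<le> card S" using \<open>z \<le> y\<close> y1 by (metis le_trans mult_le_mono2 power2_eq_square)
  finally have "y ^ (4 * s) \<le> card (stable_tuples E (4 * s) S)"
    using fin sym irr cf s ypos by (intro card_stable_tuples_ge) auto
  also have "\<dots> \<le> K * card {I \<in> stable_sets E S. card I = 4 * s}"
    unfolding K_def by (rule card_stable_tuples_le[OF fin])
  also have "\<dots> \<le> K * card (stable_sets E S)"
    using finite_stable_sets[OF fin] by (intro mult_le_mono2 card_mono) auto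
  finally have main: "y ^ (4 * s) \<le> K * card (stable_sets E S)" .
  \<comment> \<open>Half of the exponent \<open>4 * s\<close> covers the number of sets smaller than
    \<open>s\<close>; the other half absorbs \<open>2 * 4 ^ s * K\<close>, because
    \<open>2 * K <= z <= y\<close>.\<close>
  have "2 * (4 * y ^ 2) ^ s * K = (y ^ 2) ^ s * (2 * 4 ^ s * K)" by (simp add: power_mult_distrib)
  also have "\<dots> \<le> (y ^ 2) ^ s * (y ^ 2) ^ s"
  proof (rule mult_le_mono2)
    have "(4::nat) ^ s \<le> (4 * s) ^ s" using s by (intro power_mono) auto
    also have "\<dots> \<le> K" unfolding K_def using s by (intro power_increasing) auto
    finally have "2 * 4 ^ s * K \<le> 2 * K * K" by simp
    also have "\<dots> \<le> (2 * K) ^ 2" by (simp add: power2_eq_square)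
    also have "2 * K \<le> z" unfolding K_def z using s by (intro mult_le_mono2 power_mono) auto
    then have "(2 * K) ^ 2 \<le> y ^ 2" using \<open>z \<le> y\<close> by (intro power_mono) auto
    also have "\<dots> \<le> (y ^ 2) ^ s" using s ypos by (intro self_le_power) auto
    finally show "2 * 4 ^ s * K \<le> (y ^ 2) ^ s" .
  qed
  also have "\<dots> = y ^ (2 * s + 2 * s)" by (simp only: power_mult power_add)
  also have "2 * s + 2 * s = 4 * s" by simp
  also note main
  finally have "K * (2 * (4 * y ^ 2) ^ s) \<le> K * card (stable_sets E S)"
    by (simp only: mult.commute)
  moreover have "0 < K" using s by (simp add: K_def)
  ultimately have *: "2 * (4 * y ^ 2) ^ s \<le> card (stable_sets E S)"
    by (metis nat_mult_le_cancel1)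
  have "card {I \<in> stable_sets E S. card I < s} \<le> card {I. I \<subseteq> S \<and> card I < s}"
    using fin by (intro card_mono) (auto simp: stable_sets_def)
  also have "\<dots> \<le> (4 * y ^ 2) ^ s"
  proof (rule card_small_subsets_le[OF fin y2])
    have "1 \<le> y ^ 2" using ypos by simp
    then show "2 \<le> 4 * y ^ 2" by linarith
  qed
  finally show ?thesis using * by linarith
qed

text \<open>This is the inequality for one fibre in Shearer's averaging: the \<open>+ 1\<close> and
  the \<open>d\<close> belong to the outcome that contains \<open>v\<close>. If there are fewer than
  \<open>w\<close> stable sets, then \<open>d >= w ^ 2\<close> alone suffices. Otherwise at least
  half of them have \<open>s\<close> or more elements: by the previous count if
  \<open>card S >= z ^ 2\<close>, and else because \<open>S\<close> has at most
  \<open>(z ^ 2) ^ s = w / 2\<close> subsets smaller than \<open>s\<close>.\<close>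

lemma stable_sets_average:
  assumes fin: "finite S" and sym: "symp E" and irr: "irreflp E" and cf: "clique_free E r S"
    and s: "0 < s" "s \<le> r" and d: "(4 * r) ^ (20 * s ^ 2) \<le> d"
  shows "s * (card (stable_sets E S) + 1) \<le> 2 * (d + (\<Sum>I\<in>stable_sets E S. card I))"
proof -
  define z where "z = 2 * (4 * r) ^ (4 * s)"
  define w where "w = 2 * (z ^ 2) ^ s"
  let ?N = "card (stable_sets E S)"
  have finN: "finite (stable_sets E S)" by (rule finite_stable_sets[OF fin])
  have r: "4 \<le> 4 * r" using s by simp
  \<comment> \<open>Origin of the exponent 20: z^2 is at most (4 r)^(8 s + 1), so w is at most (4
    r)^(8 s^2 + s + 1), hence at most (4 r)^(10 s^2), and w^2 has to stay below d.\<close>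
  have "z ^ 2 = 4 * ((4 * r) ^ (4 * s)) ^ 2" by (simp add: z_def power_mult_distrib)
  also have "\<dots> = 4 * (4 * r) ^ (4 * s * 2)" by (simp only: power_mult)
  also have "\<dots> \<le> (4 * r) * (4 * r) ^ (4 * s * 2)" by (rule mult_le_mono1[OF r])
  finally have "z ^ 2 \<le> (4 * r) ^ Suc (4 * s * 2)" by (simp only: power_Suc)
  then have "w \<le> (4 * r) * ((4 * r) ^ Suc (4 * s * 2)) ^ s"
    unfolding w_def using r by (intro mult_le_mono power_mono) auto
  also have "\<dots> = (4 * r) ^ (1 + Suc (4 * s * 2) * s)"
    by (simp only: power_mult power_add power_one_right)
  also have "\<dots> \<le> (4 * r) ^ (10 * s ^ 2)"
  proof (rule power_increasing)
    have "s \<le> s * s" "1 \<le> s * s" using s by (simp_all add: le_square)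
    moreover have "1 + Suc (4 * s * 2) * s = 1 + s + 8 * (s * s)" by simp
    ultimately show "1 + Suc (4 * s * 2) * s \<le> 10 * s ^ 2"
      unfolding power2_eq_square by linarith
  qed (use r in simp)
  finally have "w ^ 2 \<le> ((4 * r) ^ (10 * s ^ 2)) ^ 2" by (rule power_mono) simp
  also have "\<dots> = (4 * r) ^ (20 * s ^ 2)" by (subst power_mult[symmetric]) simp
  also note d
  finally have "w ^ 2 \<le> d" .
  have z2: "2 \<le> z" using s by (simp add: z_def)
  then have z22: "2 \<le> z ^ 2" unfolding power2_eq_square by (rule le_trans[OF _ le_square])
  have "s \<le> w"
  proof -
    have "s \<le> 2 ^ s" by simp
    also have "\<dots> \<le> (z ^ 2) ^ s" using z22 by (intro power_mono) auto
    finally show ?thesis by (simp add: w_def)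
  qed
  show ?thesis
  proof (cases "?N < w")
    case True
    then have "s * (?N + 1) \<le> w * w" using \<open>s \<le> w\<close> by (intro mult_le_mono) auto
    also have "\<dots> \<le> d" using \<open>w ^ 2 \<le> d\<close> by (simp add: power2_eq_square)
    finally show ?thesis by simp
  next
    case False
    let ?A = "{I \<in> stable_sets E S. card I < s}"
    have small: "2 * card ?A \<le> ?N"
    proof (cases "z ^ 2 \<le> card S")
      case True
      then show ?thesis by (intro few_small_stable_sets[OF fin sym irr cf s z_def])
    next
      case False
      have "card ?A \<le> card {I. I \<subseteq> S \<and> card I < s}"
        using fin by (intro card_mono) (auto simp: stable_sets_def)
      also have "\<dots> \<le> (z ^ 2) ^ s"
        using False z22 by (intro card_small_subsets_le[OF fin]) auto
      finally show ?thesis using \<open>\<not> ?N < w\<close> by (simp add: w_def)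
    qed
    have "s * card (stable_sets E S - ?A) = (\<Sum>I\<in>stable_sets E S - ?A. s)" by simp
    also have "\<dots> \<le> (\<Sum>I\<in>stable_sets E S - ?A. card I)" by (intro sum_mono) auto
    also have "\<dots> \<le> (\<Sum>I\<in>stable_sets E S. card I)" using finN by (intro sum_mono2) auto
    finally have 1: "s * card (stable_sets E S - ?A) \<le> (\<Sum>I\<in>stable_sets E S. card I)" .
    have "card (stable_sets E S - ?A) = ?N - card ?A" using finN by (intro card_Diff_subset) auto
    then have "?N \<le> 2 * card (stable_sets E S - ?A)" using small by linarith
    then have "s * ?N \<le> s * (2 * card (stable_sets E S - ?A))" by (rule mult_le_mono2)
    also have "\<dots> \<le> 2 * (\<Sum>I\<in>stable_sets E S. card I)" using 1 by simp
    finally have "s * ?N \<le> 2 * (\<Sum>I\<in>stable_sets E S. card I)" .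
    moreover have "s \<le> d"
      using \<open>s \<le> w\<close> \<open>w ^ 2 \<le> d\<close> le_square[of w] unfolding power2_eq_square by linarith
    ultimately show ?thesis by simp
  qed
qed

text \<open>Shearer's averaging: for a uniformly random stable set \<open>W\<close>, fix a vertex \<open>v\<close> and condition on the
  part \<open>H\<close> of \<open>W\<close> outside the closed neighbourhood of \<open>v\<close>. Then \<open>W - H\<close> is uniform among \<open>{v}\<close> and the
  stable subsets of the neighbours of \<open>v\<close> that have no neighbour in \<open>H\<close>.\<close>

lemma stable_set_clique_free:
  assumes fin: "finite V" and sym: "symp E" and irr: "irreflp E" and cf: "clique_free E r V"
    and s: "0 < s" "s \<le> r" and d: "(4 * r) ^ (20 * s ^ 2) \<le> d"
    and deg: "\<And>v. v \<in> V \<Longrightarrow> card {u\<in>V. E v u} \<le> d"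
    and a: "\<And>I. I \<in> stable_sets E V \<Longrightarrow> card I \<le> a"
  shows "s * card V \<le> 4 * d * a"
proof -
  let ?W = "stable_sets E V"
  let ?N = "\<lambda>v. {u\<in>V. E v u}"
  have finW: "finite ?W" by (rule finite_stable_sets[OF fin])
  \<comment> \<open>For each \<open>v\<close> the weight averages at least s / 2 over all stable
    sets \<open>W\<close>. Summed over \<open>v\<close> it is at most \<open>2 * d * card W\<close>:
    the first term gives \<open>d * card W\<close>, and the second counts each member of
    \<open>W\<close> once per neighbour.\<close>
  have local: "s * card ?W \<le> 2 * (\<Sum>W\<in>?W. d * (if v \<in> W then 1 else 0) + card (?N v \<inter> W))"
    if v: "v \<in> V" for v
  proof -
    define h where "h = (\<lambda>W. d * (if v \<in> W then 1 else 0) + card (?N v \<inter> W))"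
    define g where "g = (\<lambda>W. W - insert v (?N v))"
    define T where "T = g ` ?W"
    have finT: "finite T" using finW by (simp add: T_def)
    have fibre: "s * card {W\<in>?W. g W = H} \<le> 2 * (\<Sum>W\<in>{W\<in>?W. g W = H}. h W)" if H: "H \<in> T" for H
    proof -
      define S where "S = {u\<in>?N v. \<forall>w\<in>H. \<not> E u w}"
      have finS: "finite S" using fin by (simp add: S_def)
      have HW: "H \<in> ?W" and Hv: "v \<notin> H" and HN: "H \<inter> ?N v = {}"
        using H by (auto simp: T_def g_def stable_sets_def)
      have Sv: "v \<notin> S" "S \<subseteq> ?N v" using irr by (auto simp: S_def irreflp_def)
      have finH: "finite H" using HW fin finite_subset by (auto simp: stable_sets_def)
      have eq: "{W\<in>?W. g W = H} = insert (insert v H) ((\<lambda>I. H \<union> I) ` stable_sets E S)"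
      proof (intro equalityI subsetI)
        fix W assume "W \<in> {W\<in>?W. g W = H}"
        then have W: "W \<in> ?W" and gW: "W - insert v (?N v) = H" by (auto simp: g_def)
        show "W \<in> insert (insert v H) ((\<lambda>I. H \<union> I) ` stable_sets E S)"
        proof (cases "v \<in> W")
          case True
          then have "W \<inter> ?N v = {}" using W by (auto simp: stable_sets_def)
          then have "W = insert v H" using gW True by auto
          then show ?thesis by simp
        next
          case False
          then have "W = H \<union> (W \<inter> ?N v)" using gW W by (auto simp: stable_sets_def)
          moreover have "W \<inter> ?N v \<in> stable_sets E S"
            using W gW by (auto simp: stable_sets_def S_def)
          ultimately show ?thesis by blast
        qed
      next
        fix W assume "W \<in> insert (insert v H) ((\<lambda>I. H \<union> I) ` stable_sets E S)"
        then consider "W = insert v H" | I where "W = H \<union> I" "I \<in> stable_sets E S" by auto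
        then show "W \<in> {W\<in>?W. g W = H}"
        proof cases
          case 1
          have "\<not> E v w \<and> \<not> E w v" if "w \<in> H" for w
            using that HN HW sym by (auto simp: stable_sets_def symp_def)
          then show ?thesis using 1 HW v Hv HN irr by (auto simp: stable_sets_def g_def irreflp_def)
        next
          case 2
          have "\<not> E u w \<and> \<not> E w u" if "w \<in> H" "u \<in> I" for w u
            using that 2 sym by (auto simp: stable_sets_def S_def symp_def)
          moreover have "I \<subseteq> ?N v" using 2 Sv by (auto simp: stable_sets_def)
          ultimately show ?thesis using 2 HW Hv HN by (auto simp: stable_sets_def g_def)
        qed
      qed
      have disj: "insert v H \<notin> (\<lambda>I. H \<union> I) ` stable_sets E S"
        using Hv Sv by (auto simp: stable_sets_def)
      have HS: "H \<inter> S = {}" using HN Sv by auto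
      have inj: "inj_on (\<lambda>I. H \<union> I) (stable_sets E S)"
        using HS by (auto simp: inj_on_def stable_sets_def)
      have finSS: "finite (stable_sets E S)" by (rule finite_stable_sets[OF finS])
      have c: "card {W\<in>?W. g W = H} = card (stable_sets E S) + 1"
        unfolding eq using disj finSS card_image[OF inj] by simp
      have h1: "h (insert v H) = d"
      proof -
        have "?N v \<inter> insert v H = {}" using HN irr by (auto simp: irreflp_def)
        then show ?thesis by (simp add: h_def)
      qed
      have h2: "h (H \<union> I) = card I" if "I \<in> stable_sets E S" for I
      proof -
        have "?N v \<inter> (H \<union> I) = I" using HN that Sv by (auto simp: stable_sets_def)
        moreover have "v \<notin> H \<union> I" using Hv that Sv by (auto simp: stable_sets_def)
        ultimately show ?thesis by (simp add: h_def)
      qed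
      have "(\<Sum>W\<in>{W\<in>?W. g W = H}. h W) = d + (\<Sum>I\<in>stable_sets E S. card I)"
        unfolding eq using disj finSS by (simp add: sum.reindex[OF inj] h1 h2)
      moreover have "clique_free E r S"
        by (rule clique_free_mono[OF cf]) (use Sv in auto)
      ultimately show ?thesis
        using stable_sets_average[OF finS sym irr _ s d] unfolding c by simp
    qed
    have "s * card ?W = s * (\<Sum>W\<in>?W. 1)" by simp
    also have "\<dots> = s * (\<Sum>H\<in>T. \<Sum>W\<in>{W\<in>?W. g W = H}. 1)"
      using sum.group[OF finW finT, of g "\<lambda>_. 1::nat"] by (simp add: T_def)
    also have "\<dots> = (\<Sum>H\<in>T. s * card {W\<in>?W. g W = H})" by (simp add: sum_distrib_left)
    also have "\<dots> \<le> (\<Sum>H\<in>T. 2 * (\<Sum>W\<in>{W\<in>?W. g W = H}. h W))" by (intro sum_mono fibre)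
    also have "\<dots> = 2 * (\<Sum>W\<in>?W. h W)"
      using sum.group[OF finW finT, of g h] by (simp add: T_def flip: sum_distrib_left)
    finally show ?thesis by (simp add: h_def)
  qed
  have "s * card V * card ?W = (\<Sum>v\<in>V. s * card ?W)" by simp
  also have "\<dots> \<le> (\<Sum>v\<in>V. 2 * (\<Sum>W\<in>?W. d * (if v \<in> W then 1 else 0) + card (?N v \<inter> W)))"
    by (intro sum_mono local)
  also have "\<dots> = 2 * (\<Sum>W\<in>?W. \<Sum>v\<in>V. d * (if v \<in> W then 1 else 0) + card (?N v \<inter> W))"
    unfolding sum_distrib_left[symmetric] by (subst sum.swap) simp
  also have "\<dots> \<le> 2 * (\<Sum>W\<in>?W. 2 * d * a)"
  proof (intro mult_le_mono2 sum_mono)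
    fix W assume W: "W \<in> ?W"
    then have WV: "W \<subseteq> V" by (simp add: stable_sets_def)
    have finWW: "finite W" using WV fin finite_subset by blast
    have "(\<Sum>v\<in>V. d * (if v \<in> W then 1 else 0)) = d * card W"
      using fin WV by (simp add: sum_distrib_left[symmetric] sum.If_cases Int_absorb1)
    moreover have "(\<Sum>v\<in>V. card (?N v \<inter> W)) \<le> d * card W"
    proof -
      have "(\<Sum>v\<in>V. card (?N v \<inter> W)) = (\<Sum>v\<in>V. \<Sum>w\<in>W. if E v w then 1 else 0)"
      proof (intro sum.cong refl)
        fix v
        have "?N v \<inter> W = W \<inter> {w. E v w}" using WV by auto
        then show "card (?N v \<inter> W) = (\<Sum>w\<in>W. if E v w then 1 else 0)"
          using finWW by (simp add: sum.If_cases)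
      qed
      also have "\<dots> = (\<Sum>w\<in>W. \<Sum>v\<in>V. if E v w then 1 else 0)" by (rule sum.swap)
      also have "\<dots> = (\<Sum>w\<in>W. card (?N w))"
      proof (intro sum.cong refl)
        fix w
        have "?N w = V \<inter> {v. E v w}" using sym by (auto simp: symp_def)
        then show "(\<Sum>v\<in>V. if E v w then 1 else 0) = card (?N w)"
          using fin by (simp add: sum.If_cases)
      qed
      also have "\<dots> \<le> (\<Sum>w\<in>W. d)" using WV by (intro sum_mono deg) auto
      finally show ?thesis by (simp add: mult.commute)
    qed
    ultimately have "(\<Sum>v\<in>V. d * (if v \<in> W then 1 else 0) + card (?N v \<inter> W)) \<le> 2 * d * card W"
      by (simp add: sum.distrib)
    also have "\<dots> \<le> 2 * d * a" using a[OF W] by simp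
    finally show "(\<Sum>v\<in>V. d * (if v \<in> W then 1 else 0) + card (?N v \<inter> W)) \<le> 2 * d * a" .
  qed
  finally have "card ?W * (s * card V) \<le> card ?W * (4 * d * a)" by (simp add: algebra_simps)
  moreover have "{} \<in> ?W" by (simp add: stable_sets_def)
  then have "0 < card ?W" using finW by (auto simp: card_gt_0_iff)
  ultimately show ?thesis by (metis nat_mult_le_cancel1)
qed

section \<open>Gram vectors\<close>

text \<open>The index set is arbitrary so that Schur complements can remove one index at a
  time.\<close>

definition psd_on :: "'a set \<Rightarrow> ('a \<Rightarrow> 'a \<Rightarrow> real) \<Rightarrow> bool" where
  "psd_on S Y \<longleftrightarrow> (\<forall>i\<in>S. \<forall>j\<in>S. Y i j = Y j i) \<and>
     (\<forall>x. 0 \<le> (\<Sum>i\<in>S. \<Sum>j\<in>S. x i * Y i j * x j))"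

lemma psd_on_sym: "psd_on S Y \<Longrightarrow> i \<in> S \<Longrightarrow> j \<in> S \<Longrightarrow> Y i j = Y j i"
  by (simp add: psd_on_def)

lemma psd_on_nonneg: "psd_on S Y \<Longrightarrow> 0 \<le> (\<Sum>i\<in>S. \<Sum>j\<in>S. x i * Y i j * x j)"
  by (simp add: psd_on_def)

lemma quadratic_form_insert:
  fixes Y :: "'a \<Rightarrow> 'a \<Rightarrow> real"
  assumes "finite S" "a \<notin> S" and sym: "\<And>i. i \<in> S \<Longrightarrow> Y i a = Y a i"
  shows "(\<Sum>i\<in>insert a S. \<Sum>j\<in>insert a S. x i * Y i j * x j) =
    Y a a * x a ^ 2 + 2 * x a * (\<Sum>j\<in>S. Y a j * x j) + (\<Sum>i\<in>S. \<Sum>j\<in>S. x i * Y i j * x j)"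
proof -
  have "(\<Sum>i\<in>insert a S. \<Sum>j\<in>insert a S. x i * Y i j * x j) =
     x a * Y a a * x a + (\<Sum>j\<in>S. x a * Y a j * x j) + ((\<Sum>i\<in>S. x i * Y i a * x a) + (\<Sum>i\<in>S. \<Sum>j\<in>S. x i * Y i j * x j))"
    using assms(1,2) by (simp add: sum.distrib)
  moreover have "(\<Sum>i\<in>S. x i * Y i a * x a) = x a * (\<Sum>j\<in>S. Y a j * x j)"
    unfolding sum_distrib_left using sym by (intro sum.cong) auto
  moreover have "(\<Sum>j\<in>S. x a * Y a j * x j) = x a * (\<Sum>j\<in>S. Y a j * x j)"
    unfolding sum_distrib_left by (intro sum.cong) auto
  ultimately show ?thesis by (simp add: power2_eq_square algebra_simps)
qed

text \<open>At t e_a + e_j the form equals 2 t \<open>Y a j\<close> + \<open>Y j j\<close>, which is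
  linear in t and so unbounded below unless \<open>Y a j = 0\<close>. The chosen \<open>t\<close>
  makes it -1.\<close>

lemma psd_on_diag_zero:
  assumes fin: "finite S" and "a \<notin> S" and psd: "psd_on (insert a S) Y" and 0: "Y a a = 0" and j: "j \<in> S"
  shows "Y a j = 0"
proof (rule ccontr)
  assume nz: "Y a j \<noteq> 0"
  define t where "t = - (Y j j + 1) / (2 * Y a j)"
  define x where "x = (\<lambda>i. if i = a then t else if i = j then 1 else (0::real))"
  have "0 \<le> (\<Sum>i\<in>insert a S. \<Sum>j\<in>insert a S. x i * Y i j * x j)"
    by (rule psd_on_nonneg[OF psd])
  also have "\<dots> = Y a a * x a ^ 2 + 2 * x a * (\<Sum>j\<in>S. Y a j * x j) + (\<Sum>i\<in>S. \<Sum>j\<in>S. x i * Y i j * x j)"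
    using assms by (intro quadratic_form_insert psd_on_sym[OF psd]) simp_all
  also have "(\<Sum>i\<in>S. Y a i * x i) = (\<Sum>i\<in>S. if i = j then Y a j else 0)"
    using assms by (intro sum.cong) (auto simp: x_def)
  also have "\<dots> = Y a j" using fin j by simp
  also have "(\<Sum>i\<in>S. \<Sum>k\<in>S. x i * Y i k * x k) = (\<Sum>i\<in>S. \<Sum>k\<in>S. if k = j then (if i = j then Y j j else 0) else 0)"
    using assms by (intro sum.cong) (auto simp: x_def)
  also have "\<dots> = Y j j" using fin j by simp
  finally show False using nz 0 by (simp add: x_def t_def field_simps)
qed

text \<open>Completing the square: the coordinate \<open>- c / Y a a\<close> at \<open>a\<close>
  minimizes the form when the pivot is positive. When the pivot is 0, division by zero makes both
  this coordinate and the correction term 0, so the computation still holds.\<close>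

lemma psd_on_schur:
  assumes fin: "finite S" and a: "a \<notin> S" and psd: "psd_on (insert a S) Y"
  shows "psd_on S (\<lambda>i j. Y i j - Y a i * Y a j / Y a a)"
  unfolding psd_on_def
proof (intro conjI ballI allI)
  fix i j assume "i \<in> S" "j \<in> S"
  then show "Y i j - Y a i * Y a j / Y a a = Y j i - Y a j * Y a i / Y a a"
    using psd_on_sym[OF psd, of i j] by simp
next
  fix x :: "'a \<Rightarrow> real"
  define c where "c = (\<Sum>j\<in>S. Y a j * x j)"
  define y where "y = x(a := - c / Y a a)"
  have yx: "y i = x i" if "i \<in> S" for i using that a by (auto simp: y_def)
  have "0 \<le> (\<Sum>i\<in>insert a S. \<Sum>j\<in>insert a S. y i * Y i j * y j)"
    by (rule psd_on_nonneg[OF psd])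
  also have "\<dots> = Y a a * y a ^ 2 + 2 * y a * (\<Sum>j\<in>S. Y a j * y j) + (\<Sum>i\<in>S. \<Sum>j\<in>S. y i * Y i j * y j)"
    using assms by (intro quadratic_form_insert psd_on_sym[OF psd]) simp_all
  also have "(\<Sum>j\<in>S. Y a j * y j) = c" by (simp add: c_def yx)
  also have "(\<Sum>i\<in>S. \<Sum>j\<in>S. y i * Y i j * y j) = (\<Sum>i\<in>S. \<Sum>j\<in>S. x i * Y i j * x j)"
    by (simp add: yx)
  also have "Y a a * y a ^ 2 + 2 * y a * c = - (c ^ 2 / Y a a)"
    by (simp add: y_def power2_eq_square field_simps)
  also have "c ^ 2 / Y a a = (\<Sum>i\<in>S. \<Sum>j\<in>S. x i * (Y a i * Y a j / Y a a) * x j)"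
    by (simp add: c_def power2_eq_square sum_product sum_divide_distrib mult_ac)
  also have "- (\<Sum>i\<in>S. \<Sum>j\<in>S. x i * (Y a i * Y a j / Y a a) * x j) + (\<Sum>i\<in>S. \<Sum>j\<in>S. x i * Y i j * x j)
      = (\<Sum>i\<in>S. \<Sum>j\<in>S. x i * (Y i j - Y a i * Y a j / Y a a) * x j)"
    by (simp add: algebra_simps sum_subtractf)
  finally show "0 \<le> (\<Sum>i\<in>S. \<Sum>j\<in>S. x i * (Y i j - Y a i * Y a j / Y a a) * x j)" .
qed

lemma psd_on_diag_nonneg:
  assumes "finite S" and psd: "psd_on S Y" and "a \<in> S"
  shows "0 \<le> Y a a"
proof -
  have "0 \<le> (\<Sum>i\<in>S. \<Sum>j\<in>S. (if i = a then 1 else 0) * Y i j * (if j = a then 1 else 0))"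
    by (rule psd_on_nonneg[OF psd])
  also have "\<dots> = (\<Sum>i\<in>S. \<Sum>j\<in>S. if j = a then (if i = a then Y a a else 0) else 0)"
    by (intro sum.cong) auto
  also have "\<dots> = Y a a" using assms by simp
  finally show ?thesis .
qed

text \<open>Cholesky factorization: the Schur complement removes one index. A vanishing pivot needs no separate
  Schur complement, since then division by zero yields zero and the whole row of the pivot is zero.\<close>

lemma psd_on_gram:
  assumes "finite S" and "psd_on S Y"
  shows "\<exists>v :: 'a \<Rightarrow> 'a \<Rightarrow> real. \<forall>i\<in>S. \<forall>j\<in>S. Y i j = (\<Sum>k\<in>S. v i k * v j k)"
  using assms
proof (induction S arbitrary: Y rule: finite_induct)
  case empty
  then show ?case by simp
next
  case (insert a S)
  note psd = insert.prems
  obtain v where v: "\<forall>i\<in>S. \<forall>j\<in>S. Y i j - Y a i * Y a j / Y a a = (\<Sum>k\<in>S. v i k * v j k)"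
    using insert.IH[OF psd_on_schur[OF insert.hyps(1,2) psd]] by blast
  \<comment> \<open>One Cholesky step: column \<open>a\<close> carries the rank-one part removed by
    the Schur complement, and row \<open>a\<close> vanishes off that column.\<close>
  define w where "w = (\<lambda>i k. if k = a then Y a i / sqrt (Y a a) else if i = a then 0 else v i k)"
  have nn: "0 \<le> Y a a" using psd_on_diag_nonneg[OF _ psd] insert.hyps by auto
  have sym: "Y i a = Y a i" if "i \<in> insert a S" for i using that by (intro psd_on_sym[OF psd]) auto
  have zero: "Y a i = 0" if "Y a a = 0" "i \<in> insert a S" for i
    using psd_on_diag_zero[OF insert.hyps(1,2) psd that(1)] that by auto
  have split: "(\<Sum>k\<in>insert a S. w i k * w j k) = Y a i * Y a j / Y a a + (\<Sum>k\<in>S. w i k * w j k)" for i j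
  proof -
    have "sqrt (Y a a) * sqrt (Y a a) = Y a a" using nn by simp
    then show ?thesis using insert.hyps by (simp add: w_def)
  qed
  have "Y i j = (\<Sum>k\<in>insert a S. w i k * w j k)" if "i \<in> insert a S" "j \<in> insert a S" for i j
  proof (cases "i = a \<or> j = a")
    case True
    then have "(\<Sum>k\<in>S. w i k * w j k) = 0"
      using insert.hyps by (intro sum.neutral) (auto simp: w_def)
    moreover have "Y i j = Y a i * Y a j / Y a a"
    proof (cases "Y a a = 0")
      case True
      have "Y i j = 0"
        using \<open>i = a \<or> j = a\<close> zero[OF True that(1)] zero[OF True that(2)] sym[OF that(1)] by auto
      then show ?thesis using True by simp
    next
      case False
      then show ?thesis using True sym[OF that(1)] by auto
    qed
    ultimately show ?thesis unfolding split by simp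
  next
    case False
    then have "(\<Sum>k\<in>S. w i k * w j k) = (\<Sum>k\<in>S. v i k * v j k)"
      using insert.hyps by (intro sum.cong) (auto simp: w_def)
    moreover have "i \<in> S" "j \<in> S" using False that by auto
    then have "Y i j - Y a i * Y a j / Y a a = (\<Sum>k\<in>S. v i k * v j k)" using v by blast
    ultimately show ?thesis unfolding split by simp
  qed
  then show ?case by blast
qed

section \<open>Gaussian rounding\<close>

definition normal_tail :: "real \<Rightarrow> real" where
  "normal_tail t = measure (density lborel std_normal_density) {t<..}"

section \<open>Tail estimates for the standard normal law\<close>

lemma normal_tail_eq: "normal_tail t = (\<integral>x. std_normal_density x * indicator {t<..} x \<partial>lborel)"
proof -
  interpret prob_space "density lborel std_normal_density" by (rule prob_space_normal_density) simp
  have "normal_tail t = (\<integral>x. indicator {t<..} x \<partial>density lborel std_normal_density)"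
    by (simp add: normal_tail_def)
  also have "\<dots> = (\<integral>x. std_normal_density x * indicator {t<..} x \<partial>lborel)"
    by (subst integral_real_density) auto
  finally show ?thesis .
qed

lemma normal_tail_antimono: "s \<le> t \<Longrightarrow> normal_tail t \<le> normal_tail s"
proof -
  interpret prob_space "density lborel std_normal_density" by (rule prob_space_normal_density) simp
  show "s \<le> t \<Longrightarrow> normal_tail t \<le> normal_tail s"
    unfolding normal_tail_def by (intro finite_measure_mono) auto
qed

lemma integrable_normal_tail: "integrable lborel (\<lambda>x. std_normal_density x * indicator {t<..} x)"
  using integrable_mult_indicator[of "{t<..}" lborel std_normal_density]
  by (simp add: mult.commute)

text \<open>For x > t >= 0, x^2 >= t^2 + (x - t)^2, so beyond \<open>t\<close> the density is at
  most exp(-t^2/2) times the normal density centred at \<open>t\<close>, which has mass 1.\<close>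

lemma normal_tail_le:
  assumes "0 \<le> t"
  shows "normal_tail t \<le> exp (- t\<^sup>2 / 2)"
proof -
  have "normal_tail t \<le> (\<integral>x. exp (- t\<^sup>2 / 2) * normal_density t 1 x \<partial>lborel)"
    unfolding normal_tail_eq
  proof (rule integral_mono)
    fix x :: real
    show "std_normal_density x * indicator {t<..} x \<le> exp (- t\<^sup>2 / 2) * normal_density t 1 x"
    proof (cases "x > t")
      case True
      have "t * (x - t) \<ge> 0" using True assms by simp
      then have "- x\<^sup>2 / 2 \<le> - t\<^sup>2 / 2 + - (x - t)\<^sup>2 / 2"
        by (simp add: power2_eq_square algebra_simps)
      then have "exp (- x\<^sup>2 / 2) \<le> exp (- t\<^sup>2 / 2) * exp (- (x - t)\<^sup>2 / 2)"
        by (simp flip: exp_add)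
      then have "exp (- x\<^sup>2 / 2) / sqrt (2 * pi) \<le> exp (- t\<^sup>2 / 2) * exp (- (x - t)\<^sup>2 / 2) / sqrt (2 * pi)"
        by (intro divide_right_mono) auto
      then show ?thesis using True by (simp add: normal_density_def)
    next
      case False
      then show ?thesis by simp
    qed
  qed (auto intro: integrable_normal_tail)
  then show ?thesis by simp
qed

text \<open>Only the interval from t to t + 1/t is kept. There the density is at least its value at
  the right end, and (t + 1/t)^2 <= t^2 + 3; the constant 13 bounds sqrt (2 pi) exp (3/2).\<close>

lemma normal_tail_ge:
  assumes "1 \<le> t"
  shows "exp (- t\<^sup>2 / 2) / (13 * t) \<le> normal_tail t"
proof -
  define c where "c = std_normal_density (t + 1 / t)"
  have "c * (1 / t) = (\<integral>x. c * indicator {t<..t + 1 / t} x \<partial>lborel)"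
    using assms by simp
  also have "\<dots> \<le> normal_tail t"
    unfolding normal_tail_eq
  proof (rule integral_mono)
    fix x :: real
    show "c * indicator {t<..t + 1 / t} x \<le> std_normal_density x * indicator {t<..} x"
    proof (cases "x \<in> {t<..t + 1 / t}")
      case True
      then have "x\<^sup>2 \<le> (t + 1 / t)\<^sup>2" using assms by (intro power_mono) auto
      then show ?thesis using True by (simp add: c_def normal_density_def divide_right_mono)
    qed (simp add: indicator_def)
    have "integrable lborel (indicat_real {t<..t + 1 / t})"
      using assms by (intro integrable_real_indicator) auto
    then show "integrable lborel (\<lambda>x. c * indicator {t<..t + 1 / t} x)" by simp
  qed (rule integrable_normal_tail)
  finally have "c * (1 / t) \<le> normal_tail t" .
  moreover have "exp (- t\<^sup>2 / 2) / 13 \<le> c"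
  proof -
    have "(t + 1 / t)\<^sup>2 = t\<^sup>2 + 2 + (1 / t)\<^sup>2" using assms by (simp add: power2_eq_square field_simps)
    moreover have "(1 / t)\<^sup>2 \<le> 1" using assms by (simp add: power_le_one)
    ultimately have "- t\<^sup>2 / 2 + - (3 / 2) \<le> - (t + 1 / t)\<^sup>2 / 2" by simp
    then have "exp (- t\<^sup>2 / 2) * exp (- (3 / 2)) \<le> exp (- (t + 1 / t)\<^sup>2 / 2)"
      by (simp flip: exp_add)
    moreover have "sqrt (2 * pi) * exp (3 / 2) \<le> 13"
    proof -
      have "exp (3 / 2) ^ 2 = exp (3 / 2 + 3 / 2 :: real)" by (simp only: exp_add power2_eq_square)
      also have "\<dots> = exp (1 + 1 + 1)" by simp
      also have "\<dots> = exp (1::real) ^ 3" by (simp only: exp_add power3_eq_cube)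
      also have "\<dots> \<le> (272 / 100) ^ 3" using e_less_272 by (intro power_mono) auto
      finally have "(sqrt (2 * pi) * exp (3 / 2))\<^sup>2 \<le> (2 * 4) * (272 / 100) ^ 3"
        unfolding power_mult_distrib using pi_less_4 by (intro mult_mono) auto
      also have "\<dots> \<le> 13 ^ 2" by (simp add: power2_eq_square power3_eq_cube)
      finally show ?thesis by (rule power2_le_imp_le) simp
    qed
    ultimately have le: "(exp (- t\<^sup>2 / 2) * exp (- (3 / 2))) * (sqrt (2 * pi) * exp (3 / 2)) \<le> exp (- (t + 1 / t)\<^sup>2 / 2) * 13"
      by (intro mult_mono) auto
    have cancel: "exp (- (3 / 2)) * exp (3 / 2 :: real) = 1" by (simp flip: exp_add)
    have eq: "(exp (- t\<^sup>2 / 2) * exp (- (3 / 2))) * (sqrt (2 * pi) * exp (3 / 2)) =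
        exp (- t\<^sup>2 / 2) * sqrt (2 * pi) * (exp (- (3 / 2)) * exp (3 / 2))"
      by (simp only: mult_ac)
    have "exp (- t\<^sup>2 / 2) * sqrt (2 * pi) * 1 \<le> exp (- (t + 1 / t)\<^sup>2 / 2) * 13"
      using le unfolding eq cancel .
    then have "exp (- t\<^sup>2 / 2) * sqrt (2 * pi) \<le> 13 * exp (- (t + 1 / t)\<^sup>2 / 2)"
      by simp
    then show ?thesis by (simp add: c_def normal_density_def field_simps)
  qed
  then have "exp (- t\<^sup>2 / 2) / 13 * (1 / t) \<le> c * (1 / t)"
    using assms by (intro mult_right_mono) auto
  ultimately show ?thesis by simp
qed

text \<open>A combination of independent standard normal coordinates is centred normal with variance
  the sum of the squared coefficients; dividing by the deviation standardizes it.\<close>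

lemma gaussian_linear_form:
  fixes c :: "'k \<Rightarrow> real"
  assumes fin: "finite K" and pos: "0 < \<sigma>" and \<sigma>: "(\<Sum>k\<in>K. (c k)\<^sup>2) = \<sigma>\<^sup>2"
  defines "M \<equiv> (\<Pi>\<^sub>M k\<in>K. density lborel std_normal_density)"
  shows "measure M {\<omega>\<in>space M. t < (\<Sum>k\<in>K. c k * \<omega> k)} = normal_tail (t / \<sigma>)"
proof -
  let ?N = "density lborel std_normal_density"
  interpret N: prob_space ?N by (rule prob_space_normal_density) simp
  interpret P: product_prob_space "\<lambda>_. ?N" K ..
  interpret M: prob_space M unfolding M_def by (rule prob_space_PiM) (rule N.prob_space_axioms)
  \<comment> \<open>Zero coefficients are dropped because each summand needs a normal density with
    positive deviation.\<close>
  define J where "J = {k\<in>K. c k \<noteq> 0}"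
  have JK: "J \<subseteq> K" and finJ: "finite J" using fin by (auto simp: J_def)
  have sumJ: "(\<Sum>k\<in>J. (c k)\<^sup>2) = \<sigma>\<^sup>2"
    unfolding \<sigma>[symmetric] using fin by (intro sum.mono_neutral_left) (auto simp: J_def)
  have Jne: "J \<noteq> {}" using sumJ pos by auto
  then have Kne: "K \<noteq> {}" using JK by auto
  have coord: "(\<lambda>\<omega>. \<omega> k) \<in> measurable M ?N" if "k \<in> K" for k
    unfolding M_def using that by (rule measurable_component_singleton)
  have dist: "distr M ?N (\<lambda>\<omega>. \<omega> k) = ?N" if "k \<in> K" for k
    unfolding M_def using that by (rule P.PiM_component)
  \<comment> \<open>Independence of the coordinates: their joint law, which is \<open>M\<close>
    itself, is the product of the marginals.\<close>
  have "distr M (\<Pi>\<^sub>M k\<in>K. ?N) (\<lambda>\<omega>. \<lambda>k\<in>K. \<omega> k) = distr M M (\<lambda>\<omega>. \<omega>)"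
    by (intro distr_cong) (auto simp: M_def space_PiM)
  also have "\<dots> = (\<Pi>\<^sub>M k\<in>K. distr M ?N (\<lambda>\<omega>. \<omega> k))"
    unfolding distr_id M_def using dist by (intro PiM_cong) (auto simp: M_def)
  finally have "M.indep_vars (\<lambda>_. ?N) (\<lambda>k \<omega>. \<omega> k) K"
    using M.indep_vars_iff_distr_eq_PiM'[OF Kne coord] by simp
  then have "M.indep_vars (\<lambda>_. ?N) (\<lambda>k \<omega>. \<omega> k) J"
    using JK by (rule M.indep_vars_subset)
  then have ind: "M.indep_vars (\<lambda>_. borel) (\<lambda>k \<omega>. c k * \<omega> k) J"
    by (rule M.indep_vars_compose2) simp
  have std: "distributed M lborel (\<lambda>\<omega>. \<omega> k) std_normal_density" if "k \<in> K" for k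
  proof -
    have "distr M lborel (\<lambda>\<omega>. \<omega> k) = distr M ?N (\<lambda>\<omega>. \<omega> k)" by (rule distr_cong) auto
    then show ?thesis using dist[OF that] coord[OF that] by (auto simp: distributed_def)
  qed
  have nrm: "distributed M lborel (\<lambda>\<omega>. c k * \<omega> k) (normal_density 0 \<bar>c k\<bar>)" if "k \<in> J" for k
    using M.normal_density_affine[OF std[of k], of "c k" 0] that by (simp add: J_def)
  have "distributed M lborel (\<lambda>\<omega>. \<Sum>k\<in>J. c k * \<omega> k) (normal_density (\<Sum>k\<in>J. 0) (sqrt (\<Sum>k\<in>J. \<bar>c k\<bar>\<^sup>2)))"
    by (intro M.sum_indep_normal finJ Jne ind nrm) (auto simp: J_def)
  then have "distributed M lborel (\<lambda>\<omega>. \<Sum>k\<in>J. c k * \<omega> k) (normal_density 0 \<sigma>)"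
    using pos by (simp add: sumJ)
  then have D: "distributed M lborel (\<lambda>\<omega>. ((\<Sum>k\<in>J. c k * \<omega> k) - 0) / \<sigma>) std_normal_density"
    by (rule M.normal_standard_normal_convert[OF pos, THEN iffD1])
  let ?X = "\<lambda>\<omega>. ((\<Sum>k\<in>J. c k * \<omega> k) - 0) / \<sigma>"
  have X: "?X \<in> measurable M lborel" using D by (rule distributed_measurable)
  have "normal_tail (t / \<sigma>) = measure (distr M lborel ?X) {t / \<sigma><..}"
    unfolding normal_tail_def using distributed_distr_eq_density[OF D] by simp
  also have "\<dots> = measure M (?X -` {t / \<sigma><..} \<inter> space M)"
    by (rule measure_distr[OF X]) simp
  also have "?X -` {t / \<sigma><..} \<inter> space M = {\<omega>\<in>space M. t < (\<Sum>k\<in>K. c k * \<omega> k)}"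
  proof -
    have "(\<Sum>k\<in>J. c k * \<omega> k) = (\<Sum>k\<in>K. c k * \<omega> k)" for \<omega> :: "'k \<Rightarrow> real"
      using fin by (intro sum.mono_neutral_left) (auto simp: J_def)
    then show ?thesis using pos by (auto simp: field_simps)
  qed
  finally show ?thesis ..
qed

text \<open>Choose a Gaussian vector and keep the vertices whose unit vector has inner product above \<open>t\<close> with it while
  no neighbour's does. Along an edge the sum \<open>u i + u j\<close> is short, so both ends are rarely selected.\<close>

lemma gaussian_rounding:
  fixes u :: "'a \<Rightarrow> 'k \<Rightarrow> real"
  assumes finV: "finite V" and finK: "finite K" and t: "0 \<le> t" and b: "b < 1"
    and unit: "\<And>i. i \<in> V \<Longrightarrow> (\<Sum>k\<in>K. (u i k)\<^sup>2) = 1"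
    and edge: "\<And>i j. i \<in> V \<Longrightarrow> j \<in> V \<Longrightarrow> E i j \<Longrightarrow> (\<Sum>k\<in>K. u i k * u j k) \<le> - b"
    and deg: "\<And>v. v \<in> V \<Longrightarrow> card {w\<in>V. E v w} \<le> d"
    and a: "\<And>I. I \<in> stable_sets E V \<Longrightarrow> card I \<le> a"
  shows "card V * (normal_tail t - d * normal_tail (t * sqrt (2 / (1 - b)))) \<le> a"
proof -
  let ?N = "density lborel std_normal_density"
  define M where "M = (\<Pi>\<^sub>M k\<in>K. ?N)"
  interpret N: prob_space ?N by (rule prob_space_normal_density) simp
  interpret M: prob_space M unfolding M_def by (rule prob_space_PiM) (rule N.prob_space_axioms)
  let ?q = "normal_tail (t * sqrt (2 / (1 - b)))"
  define f where "f = (\<lambda>i \<omega>. \<Sum>k\<in>K. u i k * \<omega> k)"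
  have [measurable]: "f i \<in> borel_measurable M" for i
    unfolding f_def M_def by measurable
  define A where "A = (\<lambda>i. {\<omega>\<in>space M. t < f i \<omega>})"
  have A[measurable]: "A i \<in> sets M" for i unfolding A_def by measurable
  have pA: "measure M (A i) = normal_tail t" if "i \<in> V" for i
    using gaussian_linear_form[OF finK, of 1 "u i" t] unit[OF that] by (simp add: A_def f_def M_def)
  have pB: "measure M (A i \<inter> A j) \<le> ?q" if ij: "i \<in> V" "j \<in> V" "E i j" for i j
  proof -
    \<comment> \<open>The squared length of \<open>u i + u j\<close>. If both ends exceed
      \<open>t\<close>, a centred normal variable of deviation sqrt s exceeds
      \<open>2 * t\<close>.\<close>
    define s where "s = (\<Sum>k\<in>K. (u i k + u j k)\<^sup>2)"
    have "s = (\<Sum>k\<in>K. (u i k)\<^sup>2) + (\<Sum>k\<in>K. (u j k)\<^sup>2) + 2 * (\<Sum>k\<in>K. u i k * u j k)"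
      unfolding s_def power2_sum by (simp add: sum.distrib sum_distrib_left mult.assoc)
    then have s: "s \<le> 2 * (1 - b)" using unit edge ij by simp
    have s0: "0 \<le> s" unfolding s_def by (intro sum_nonneg) auto
    let ?C = "{\<omega>\<in>space M. 2 * t < (\<Sum>k\<in>K. (u i k + u j k) * \<omega> k)}"
    have sub: "A i \<inter> A j \<subseteq> ?C" by (auto simp: A_def f_def distrib_right sum.distrib)
    show ?thesis
    \<comment> \<open>Antipodal vectors give a degenerate normal law; then the two inner products
      are opposite and cannot both exceed \<open>t >= 0\<close>.\<close>
    proof (cases "s = 0")
      case True
      then have "u i k + u j k = 0" if "k \<in> K" for k
        using that finK by (simp add: s_def sum_nonneg_eq_0_iff)
      then have "?C = {}" using t by auto
      then have "A i \<inter> A j = {}" using sub by auto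
      then show ?thesis by (simp add: normal_tail_def)
    next
      case False
      then have "0 < sqrt s" using s0 by simp
      have "measure M (A i \<inter> A j) \<le> measure M ?C"
        using sub by (intro M.finite_measure_mono) (auto simp: M_def)
      also have "\<dots> = normal_tail (2 * t / sqrt s)"
        unfolding M_def using finK \<open>0 < sqrt s\<close> s0 by (intro gaussian_linear_form) (auto simp: s_def)
      also have "\<dots> \<le> ?q"
      proof (rule normal_tail_antimono)
        have "2 / (1 - b) = 2\<^sup>2 / (2 * (1 - b))" using b by (simp add: divide_simps)
        then have "sqrt (2 / (1 - b)) = 2 / sqrt (2 * (1 - b))"
          by (simp only: real_sqrt_divide real_sqrt_abs abs_numeral)
        also have "\<dots> \<le> 2 / sqrt s" using s \<open>0 < sqrt s\<close> by (intro divide_left_mono) auto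
        finally have "t * sqrt (2 / (1 - b)) \<le> t * (2 / sqrt s)"
          using t by (intro mult_left_mono)
        then show "t * sqrt (2 / (1 - b)) \<le> 2 * t / sqrt s" by (simp add: mult.commute)
      qed
      finally show ?thesis .
    qed
  qed
  \<comment> \<open>Each summand is at most 1, and at most 0 unless \<open>i\<close> is selected
    without a selected neighbour. So \<open>?X\<close> bounds the size of the rounded stable set
    from below, and its expectation needs only single and pair probabilities.\<close>
  let ?X = "\<lambda>\<omega>. \<Sum>i\<in>V. indicator (A i) \<omega> - (\<Sum>j\<in>{w\<in>V. E i w}. indicator (A i \<inter> A j) \<omega> :: real)"
  have ind: "integrable M (indicat_real B)" if "B \<in> sets M" for B
    using that by (intro integrable_real_indicator) (auto simp: M.emeasure_eq_measure)
  have int1: "integrable M (\<lambda>\<omega>. \<Sum>j\<in>{w\<in>V. E i w}. indicat_real (A i \<inter> A j) \<omega>)" for i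
    by (intro Bochner_Integration.integrable_sum ind sets.Int A)
  have int2: "integrable M (\<lambda>\<omega>. indicat_real (A i) \<omega> - (\<Sum>j\<in>{w\<in>V. E i w}. indicat_real (A i \<inter> A j) \<omega>))" for i
    by (intro Bochner_Integration.integrable_diff int1 ind A)
  have int: "integrable M ?X"
    by (intro Bochner_Integration.integrable_sum int2)
  have ind_eq: "(\<integral>\<omega>. indicat_real B \<omega> \<partial>M) = measure M B" if "B \<in> sets M" for B
    using that sets.sets_into_space[OF that] by (simp add: Int_absorb2)
  have "real (card V) * (normal_tail t - d * ?q) = (\<Sum>i\<in>V. normal_tail t - d * ?q)" by simp
  also have "\<dots> \<le> (\<Sum>i\<in>V. measure M (A i) - (\<Sum>j\<in>{w\<in>V. E i w}. measure M (A i \<inter> A j)))"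
  proof (intro sum_mono diff_mono)
    fix i assume i: "i \<in> V"
    have "(\<Sum>j\<in>{w\<in>V. E i w}. measure M (A i \<inter> A j)) \<le> (\<Sum>j\<in>{w\<in>V. E i w}. ?q)"
      using pB i by (intro sum_mono) auto
    also have "\<dots> = card {w\<in>V. E i w} * ?q" by simp
    also have "\<dots> \<le> d * ?q" using deg[OF i] by (intro mult_right_mono) (auto simp: normal_tail_def)
    finally show "(\<Sum>j\<in>{w\<in>V. E i w}. measure M (A i \<inter> A j)) \<le> d * ?q" .
  qed (simp add: pA)
  also have "\<dots> = (\<integral>\<omega>. ?X \<omega> \<partial>M)"
    unfolding Bochner_Integration.integral_sum[OF int2] Bochner_Integration.integral_diff[OF ind[OF A] int1]
      Bochner_Integration.integral_sum[OF ind[OF sets.Int[OF A A]]]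
      ind_eq[OF A] ind_eq[OF sets.Int[OF A A]] ..
  also have "\<dots> \<le> a"
  proof (rule M.integral_le_const[OF int], rule AE_I2)
    fix \<omega> assume "\<omega> \<in> space M"
    define I where "I = {i\<in>V. \<omega> \<in> A i \<and> (\<forall>j\<in>V. E i j \<longrightarrow> \<omega> \<notin> A j)}"
    have "?X \<omega> \<le> (\<Sum>i\<in>V. if i \<in> I then 1 else 0)"
    proof (rule sum_mono)
      fix i assume i: "i \<in> V"
      have nn: "0 \<le> (\<Sum>j\<in>{w\<in>V. E i w}. indicator (A i \<inter> A j) \<omega> :: real)" by (intro sum_nonneg) auto
      show "indicator (A i) \<omega> - (\<Sum>j\<in>{w\<in>V. E i w}. indicator (A i \<inter> A j) \<omega> :: real) \<le> (if i \<in> I then 1 else 0)"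
      proof (cases "\<exists>j\<in>V. E i j \<and> \<omega> \<in> A i \<inter> A j")
        case True
        then obtain j where j: "j \<in> {w\<in>V. E i w}" "\<omega> \<in> A i \<inter> A j" by auto
        have "indicator (A i \<inter> A j) \<omega> \<le> (\<Sum>j\<in>{w\<in>V. E i w}. indicator (A i \<inter> A j) \<omega> :: real)"
          using j(1) finV by (intro member_le_sum) auto
        moreover have "indicator (A i \<inter> A j) \<omega> = (1::real)" "indicator (A i) \<omega> = (1::real)"
          using j(2) by (simp_all add: indicator_def)
        ultimately show ?thesis by simp
      next
        case False
        show ?thesis
        proof (cases "\<omega> \<in> A i")
          case True
          then have "i \<in> I" using False i by (simp add: I_def)
          then show ?thesis using nn True by simp
        next
          case False
          then have "indicator (A i) \<omega> = (0::real)" by simp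
          moreover have "(0::real) \<le> (if i \<in> I then 1 else 0)" by simp
          ultimately show ?thesis using nn by linarith
        qed
      qed
    qed
    also have "\<dots> = card I"
    proof -
      have "V \<inter> I = I" by (auto simp: I_def)
      then show ?thesis using finV by (simp add: sum.If_cases)
    qed
    also have "\<dots> \<le> a"
    proof -
      have "I \<in> stable_sets E V" unfolding stable_sets_def I_def by auto
      then show ?thesis using a by simp
    qed
    finally show "?X \<omega> \<le> a" .
  qed
  finally show ?thesis .
qed

section \<open>The integrality gap\<close>

lemma card_le_alpha:
  assumes "I \<in> stable_sets E V" and "V \<subseteq> {1..n}"
  shows "card I \<le> alpha n E"
proof -
  have "finite {S. independent_set n E S}"
    by (rule finite_subset[of _ "Pow {1..n}"]) (auto simp: independent_set_def)
  moreover have "I \<in> {S. independent_set n E S}"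
    using assms by (auto simp: stable_sets_def independent_set_def)
  ultimately show ?thesis unfolding alpha_def by (intro Max_ge finite_imageI imageI)
qed

text \<open>A maximum stable set cannot be extended, so its closed neighbourhoods, of at most d + 1
  vertices each, cover the graph.\<close>

lemma vertices_le_degree_mult_alpha:
  assumes g: "simple_graph n E" and deg: "max_degree_le n E d"
  shows "n \<le> (d + 1) * alpha n E"
proof -
  let ?F = "{S. independent_set n E S}"
  have fin: "finite ?F"
    by (rule finite_subset[of _ "Pow {1..n}"]) (auto simp: independent_set_def)
  have "{} \<in> ?F" by (simp add: independent_set_def)
  then have "alpha n E \<in> card ` ?F" unfolding alpha_def using fin by (intro Max_in) auto
  then obtain I where I: "independent_set n E I" and cI: "alpha n E = card I" by auto
  have sub: "I \<subseteq> {1..n}" using I by (simp add: independent_set_def)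
  have finI: "finite I" using sub finite_subset by blast
  have "{1..n} \<subseteq> (\<Union>i\<in>I. insert i {j\<in>{1..n}. E i j})"
  proof
    fix v assume v: "v \<in> {1..n}"
    show "v \<in> (\<Union>i\<in>I. insert i {j\<in>{1..n}. E i j})"
    proof (rule ccontr)
      assume neg: "\<not> ?thesis"
      then have "v \<notin> I" and "\<forall>i\<in>I. \<not> E i v" using v by auto
      then have "independent_set n E (insert v I)"
        using I v g by (auto simp: independent_set_def simple_graph_def)
      then have "card (insert v I) \<le> alpha n E"
        by (intro card_le_alpha[of _ E "{1..n}"]) (auto simp: stable_sets_def independent_set_def)
      then show False using cI \<open>v \<notin> I\<close> finI by simp
    qed
  qed
  then have "card {1..n} \<le> card (\<Union>i\<in>I. insert i {j\<in>{1..n}. E i j})"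
    using finI by (intro card_mono) auto
  also have "\<dots> \<le> (\<Sum>i\<in>I. card (insert i {j\<in>{1..n}. E i j}))" by (rule card_UN_le[OF finI])
  also have "\<dots> \<le> (\<Sum>i\<in>I. d + 1)"
  proof (rule sum_mono)
    fix i assume "i \<in> I"
    then have "card {j\<in>{1..n}. E i j} \<le> d" using sub deg by (auto simp: max_degree_le_def Defs.degree_def)
    then show "card (insert i {j\<in>{1..n}. E i j}) \<le> d + 1"
      by (simp add: card_insert_if)
  qed
  finally show ?thesis using cI by (simp add: mult.commute)
qed

section \<open>Bounds on the objective value of one feasible matrix\<close>

locale theta_solution =
  fixes n d :: nat and E :: "nat \<Rightarrow> nat \<Rightarrow> bool" and Y :: "nat \<Rightarrow> nat \<Rightarrow> real"
  assumes graph: "simple_graph n E" and max_deg: "max_degree_le n E d" and feasible: "sdp_feasible n E Y"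
begin

lemma symE: "symp E" and irrE: "irreflp E"
  using graph by (auto simp: simple_graph_def symp_def irreflp_def)

lemma degree_within:
  assumes "V \<subseteq> {1..n}" "v \<in> V"
  shows "card {w\<in>V. E v w} \<le> d"
proof -
  have "card {w\<in>V. E v w} \<le> card {w\<in>{1..n}. E v w}" using assms by (intro card_mono) auto
  also have "\<dots> \<le> d" using max_deg assms by (auto simp: max_degree_le_def Defs.degree_def)
  finally show ?thesis .
qed

lemma psd: "psd_on (insert 0 {1..n}) Y"
proof -
  have "insert 0 {1..n} = {0..n}" by auto
  then show ?thesis using feasible by (simp add: psd_on_def sdp_feasible_def)
qed

lemma Y00: "Y 0 0 = 1" and Y0: "i \<in> {1..n} \<Longrightarrow> Y 0 i = Y i i"
  and Yedge: "i \<in> {1..n} \<Longrightarrow> j \<in> {1..n} \<Longrightarrow> E i j \<Longrightarrow> Y i j = 0"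
  using feasible by (simp_all add: sdp_feasible_def)

text \<open>Test the form on e_0 minus the indicator of \<open>Q\<close>: off-diagonal entries
  inside a clique vanish, leaving 1 - 2 X + X, where X is the sum in question.\<close>

lemma clique_sum_le:
  assumes Q: "Q \<subseteq> {1..n}" "pairwise E Q"
  shows "(\<Sum>i\<in>Q. Y i i) \<le> 1"
proof -
  define x where "x = (\<lambda>i. if i = 0 then 1 else if i \<in> Q then -1 else (0::real))"
  have x0: "x i = (if i \<in> Q then -1 else 0)" if "i \<in> {1..n}" for i using that by (auto simp: x_def)
  have "0 \<le> (\<Sum>i\<in>insert 0 {1..n}. \<Sum>j\<in>insert 0 {1..n}. x i * Y i j * x j)"
    by (rule psd_on_nonneg[OF psd])
  also have "\<dots> = Y 0 0 * x 0 ^ 2 + 2 * x 0 * (\<Sum>j\<in>{1..n}. Y 0 j * x j) + (\<Sum>i\<in>{1..n}. \<Sum>j\<in>{1..n}. x i * Y i j * x j)"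
    by (intro quadratic_form_insert psd_on_sym[OF psd]) simp_all
  also have "(\<Sum>j\<in>{1..n}. Y 0 j * x j) = (\<Sum>j\<in>{1..n}. if j \<in> Q then - Y j j else 0)"
    using Y0 x0 by (intro sum.cong) auto
  also have "\<dots> = - (\<Sum>i\<in>Q. Y i i)"
    using Q by (simp add: sum.If_cases Int_absorb1 sum_negf)
  also have "(\<Sum>i\<in>{1..n}. \<Sum>j\<in>{1..n}. x i * Y i j * x j) = (\<Sum>i\<in>{1..n}. \<Sum>j\<in>{1..n}. if j = i then if i \<in> Q then Y i i else 0 else 0)"
  proof (intro sum.cong refl)
    fix i j assume ij: "i \<in> {1..n}" "j \<in> {1..n}"
    show "x i * Y i j * x j = (if j = i then if i \<in> Q then Y i i else 0 else 0)"
    proof (cases "i \<in> Q \<and> j \<in> Q \<and> i \<noteq> j")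
      case True
      then have "E i j" using Q(2) by (simp add: pairwise_def)
      then show ?thesis using True Yedge[OF ij] by simp
    next
      case False
      then show ?thesis using x0[OF ij(1)] x0[OF ij(2)] by auto
    qed
  qed
  also have "\<dots> = (\<Sum>i\<in>{1..n}. if i \<in> Q then Y i i else 0)" by (intro sum.cong) auto
  also have "\<dots> = (\<Sum>i\<in>Q. Y i i)" using Q by (simp add: sum.If_cases Int_absorb1)
  finally show ?thesis using Y00 by (simp add: x_def)
qed

lemma diag_le_1: "i \<in> {1..n} \<Longrightarrow> Y i i \<le> 1"
  using clique_sum_le[of "{i}"] by simp

lemma edge_sum_le:
  assumes "i \<in> {1..n}" "j \<in> {1..n}" "E i j"
  shows "Y i i + Y j j \<le> 1"
proof -
  have "i \<noteq> j" "E j i" using assms(3) symE irrE by (auto simp: irreflp_def symp_def)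
  then show ?thesis using clique_sum_le[of "{i, j}"] assms by (simp add: pairwise_insert)
qed

text \<open>Normalized projections of the SDP vectors to the orthogonal complement of \<open>v\<^sub>0\<close>. If \<open>Y i i = 1\<close> the
  projection vanishes, but then \<open>i\<close> is isolated in \<open>V\<close> and any unit vector will do.\<close>

lemma unit_vectors:
  assumes "0 \<le> b" and V: "\<And>i. i \<in> V \<Longrightarrow> i \<in> {1..n} \<and> b < Y i i"
  obtains u :: "nat \<Rightarrow> nat \<Rightarrow> real"
    where "\<And>i. i \<in> V \<Longrightarrow> (\<Sum>k\<in>{1..n}. (u i k)\<^sup>2) = 1"
      and "\<And>i j. i \<in> V \<Longrightarrow> j \<in> V \<Longrightarrow> E i j \<Longrightarrow> (\<Sum>k\<in>{1..n}. u i k * u j k) \<le> - b"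
proof -
  obtain v where v: "\<forall>i\<in>{1..n}. \<forall>j\<in>{1..n}. Y i j - Y 0 i * Y 0 j / Y 0 0 = (\<Sum>k\<in>{1..n}. v i k * v j k)"
    using psd_on_gram[OF _ psd_on_schur[OF _ _ psd]] by auto
  \<comment> \<open>The squared length of the projected vector: the Schur complement at index 0 has
    entries \<open>Y i j - Y i i * Y j j\<close>.\<close>
  define c where "c = (\<lambda>i. Y i i * (1 - Y i i))"
  define u where "u = (\<lambda>i k. if Y i i = 1 then (if k = i then 1 else 0) else v i k / sqrt (c i))"
  have vv: "(\<Sum>k\<in>{1..n}. v i k * v j k) = Y i j - Y i i * Y j j" if "i \<in> {1..n}" "j \<in> {1..n}" for i j
  proof -
    have "Y i j - Y 0 i * Y 0 j / Y 0 0 = (\<Sum>k\<in>{1..n}. v i k * v j k)" using v that by blast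
    then show ?thesis using that by (simp add: Y00 Y0)
  qed
  show ?thesis
  proof (rule that[of u])
    fix i assume i: "i \<in> V"
    then have iV: "i \<in> {1..n}" "0 < Y i i" using V[OF i] assms(1) by auto
    show "(\<Sum>k\<in>{1..n}. (u i k)\<^sup>2) = 1"
    proof (cases "Y i i = 1")
      case True
      then have "(\<Sum>k\<in>{1..n}. (u i k)\<^sup>2) = (\<Sum>k\<in>{1..n}. if k = i then 1 else 0)"
        by (intro sum.cong) (auto simp: u_def)
      then show ?thesis using iV by simp
    next
      case False
      then have "0 < c i" using iV diag_le_1[OF iV(1)] by (simp add: c_def)
      have "(\<Sum>k\<in>{1..n}. (u i k)\<^sup>2) = (\<Sum>k\<in>{1..n}. v i k * v i k) / c i"
        using False \<open>0 < c i\<close> by (simp add: u_def power_divide sum_divide_distrib power2_eq_square)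
      also have "(\<Sum>k\<in>{1..n}. v i k * v i k) = c i" using vv[OF iV(1) iV(1)] by (simp add: c_def algebra_simps)
      finally show ?thesis using \<open>0 < c i\<close> by simp
    qed
  next
    fix i j assume ij: "i \<in> V" "j \<in> V" "E i j"
    have iV: "i \<in> {1..n}" "b < Y i i" and jV: "j \<in> {1..n}" "b < Y j j" using V[OF ij(1)] V[OF ij(2)] by auto
    have sum1: "Y i i + Y j j \<le> 1" using edge_sum_le iV jV ij by blast
    then have lt: "Y i i < 1" "Y j j < 1" using iV jV assms(1) by linarith+
    have pos: "0 < c i" "0 < c j" using lt iV jV assms(1) by (auto simp: c_def)
    have "(\<Sum>k\<in>{1..n}. u i k * u j k) = (\<Sum>k\<in>{1..n}. v i k * v j k) / (sqrt (c i) * sqrt (c j))"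
      using lt by (simp add: u_def sum_divide_distrib)
    also have "\<dots> = - (Y i i * Y j j / sqrt (c i * c j))"
      using vv[OF iV(1) jV(1)] Yedge[OF iV(1) jV(1) ij(3)] by (simp add: real_sqrt_mult)
    also have "\<dots> \<le> - b"
    proof -
      \<comment> \<open>Along an edge the inner product is minus the square root of x y / ((1 - x)
        (1 - y)), with x = \<open>Y i i\<close> and y = \<open>Y j j\<close>. Here x and y exceed
        \<open>b\<close> while 1 - x and 1 - y are at most 1; the comparison is made with
        squares.\<close>
      have "b\<^sup>2 * ((1 - Y i i) * (1 - Y j j)) \<le> b\<^sup>2 * 1"
        using lt iV jV assms(1) by (intro mult_left_mono mult_le_one) auto
      also have "\<dots> \<le> Y i i * Y j j"
        unfolding power2_eq_square using iV jV assms(1) by (simp add: mult_mono)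
      finally have "b\<^sup>2 * ((1 - Y i i) * (1 - Y j j)) \<le> Y i i * Y j j" .
      then have "(Y i i * Y j j) * (b\<^sup>2 * ((1 - Y i i) * (1 - Y j j))) \<le> (Y i i * Y j j) * (Y i i * Y j j)"
        using iV jV assms(1) by (intro mult_left_mono) auto
      then have "b\<^sup>2 * (c i * c j) \<le> (Y i i * Y j j)\<^sup>2"
        by (simp add: c_def power2_eq_square mult_ac)
      then have "sqrt (b\<^sup>2 * (c i * c j)) \<le> Y i i * Y j j"
        using iV jV assms(1) by (intro real_le_lsqrt) auto
      then have "b * sqrt (c i * c j) \<le> Y i i * Y j j"
        using assms(1) by (simp add: real_sqrt_mult)
      then show ?thesis using pos by (simp add: pos_le_divide_eq)
    qed
    finally show "(\<Sum>k\<in>{1..n}. u i k * u j k) \<le> - b" .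
  qed
qed

text \<open>The threshold \<open>t\<^sup>2 = 2 l (1 - b)\<close> makes the expected loss from edges exactly \<open>d * d powr - 2\<close> per vertex,
  against a gain of order \<open>d powr (b - 1) = l ^ 3 / d\<close>.\<close>

lemma card_large:
  defines "l \<equiv> ln (real d)"
  assumes b: "b = 3 * ln l / l" "0 \<le> b" and l: "0 < l" "1 \<le> 2 * l * (1 - b)"
  shows "card {i\<in>{1..n}. b < Y i i} * (l ^ 3 / (13 * sqrt (2 * l)) - 1) \<le> real d * alpha n E"
proof -
  let ?V = "{i\<in>{1..n}. b < Y i i}"
  have d: "0 < real d" "exp l = real d"
  proof -
    show "0 < real d" using l(1) by (cases "d = 0") (auto simp: l_def)
    then show "exp l = real d" by (simp add: l_def)
  qed
  have b1: "b < 1"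
  proof (rule ccontr)
    assume "\<not> b < 1"
    then have "2 * l * (1 - b) \<le> 0" using l(1) by (intro mult_nonneg_nonpos) auto
    then show False using l(2) by simp
  qed
  define t where "t = sqrt (2 * l * (1 - b))"
  have t2: "t\<^sup>2 = 2 * l * (1 - b)" using l by (simp add: t_def)
  have t1: "1 \<le> t" using l by (simp add: t_def)
  obtain u where u: "\<And>i. i \<in> ?V \<Longrightarrow> (\<Sum>k\<in>{1..n}. (u i k)\<^sup>2) = (1::real)"
      "\<And>i j. i \<in> ?V \<Longrightarrow> j \<in> ?V \<Longrightarrow> E i j \<Longrightarrow> (\<Sum>k\<in>{1..n}. u i k * u j k) \<le> - b"
    using unit_vectors[OF b(2), of ?V] by blast
  have round: "card ?V * (normal_tail t - d * normal_tail (t * sqrt (2 / (1 - b)))) \<le> alpha n E"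
  proof (rule gaussian_rounding[OF _ _ _ b1 u])
    show "card {w\<in>?V. E v w} \<le> d" if "v \<in> ?V" for v
      using that by (intro degree_within) auto
    show "card I \<le> alpha n E" if "I \<in> stable_sets E ?V" for I
      by (rule card_le_alpha[OF that]) auto
  qed (use t1 in auto)
  \<comment> \<open>The tail estimate costs a factor \<open>13 * t\<close>, at most
    \<open>13 * sqrt (2 * l)\<close>, so a gain of order l^(5/2) / d remains.\<close>
  have "l ^ 3 / (13 * sqrt (2 * l)) / d \<le> exp (- t\<^sup>2 / 2) / (13 * t)"
  proof -
    have "- t\<^sup>2 / 2 = 3 * ln l - l"
      unfolding t2 b(1) using l by (simp add: field_simps)
    then have "exp (- t\<^sup>2 / 2) = l ^ 3 / d"
      using l d by (simp add: exp_diff exp_of_nat_mult[of 3 "ln l", simplified])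
    moreover have "t \<le> sqrt (2 * l)" unfolding t_def using l b by (intro real_sqrt_le_mono) simp
    ultimately show ?thesis using t1 l d by (simp add: frac_le)
  qed
  also have "\<dots> \<le> normal_tail t" by (rule normal_tail_ge[OF t1])
  finally have low: "l ^ 3 / (13 * sqrt (2 * l)) / d \<le> normal_tail t" .
  have "normal_tail (t * sqrt (2 / (1 - b))) \<le> exp (- (t * sqrt (2 / (1 - b)))\<^sup>2 / 2)"
    using t1 b1 by (intro normal_tail_le) auto
  also have "- (t * sqrt (2 / (1 - b)))\<^sup>2 / 2 = - (l + l)"
    using b1 by (simp add: power_mult_distrib t2 field_simps)
  also have "exp (- (l + l)) = 1 / d / d" by (simp only: exp_minus exp_add d) (simp add: field_simps)
  finally have "d * normal_tail (t * sqrt (2 / (1 - b))) \<le> d * (1 / d / d)"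
    using d by (intro mult_left_mono) auto
  also have "\<dots> = 1 / d" using d by simp
  finally have "(l ^ 3 / (13 * sqrt (2 * l)) - 1) / d \<le> normal_tail t - d * normal_tail (t * sqrt (2 / (1 - b)))"
    using low by (simp add: diff_divide_distrib)
  then have "card ?V * ((l ^ 3 / (13 * sqrt (2 * l)) - 1) / d) \<le> card ?V * (normal_tail t - d * normal_tail (t * sqrt (2 / (1 - b))))"
    by (intro mult_left_mono) auto
  also note round
  finally show ?thesis using d by (simp add: field_simps)
qed

text \<open>Shearer's bound with r = ceiling of l^2 and s = floor of q: a clique of \<open>r\<close>
  vertices would have diagonal sum above 1. The 60 in \<open>q\<close> is 3 * 20: since
  \<open>4 * r <= l ^ 3\<close>, the power (4 r)^(20 s^2) is at most exp (60 s^2 ln l), hence at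
  most exp l = d. Rounding \<open>q\<close> down loses a factor 2, turning 4 into 8.\<close>

lemma card_middle:
  fixes l q :: real
  defines "l \<equiv> ln (real d)"
  defines "q \<equiv> sqrt (l / (60 * ln l))"
  assumes l: "1 \<le> l" "1 \<le> ln l" "4 * (l\<^sup>2 + 1) \<le> l ^ 3" and q: "1 \<le> q" "q \<le> l\<^sup>2"
  shows "card {i\<in>{1..n}. 1 / l\<^sup>2 < Y i i \<and> Y i i \<le> b} * q \<le> 8 * real d * alpha n E"
proof -
  let ?V = "{i\<in>{1..n}. 1 / l\<^sup>2 < Y i i \<and> Y i i \<le> b}"
  define r where "r = nat \<lceil>l\<^sup>2\<rceil>"
  define s where "s = nat \<lfloor>q\<rfloor>"
  have d: "0 < real d" using l(1) by (cases "d = 0") (auto simp: l_def)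
  have "0 \<le> l\<^sup>2" by simp
  then have "0 \<le> \<lceil>l\<^sup>2\<rceil>" by linarith
  then have "real r = of_int \<lceil>l\<^sup>2\<rceil>" by (simp add: r_def)
  then have r: "l\<^sup>2 \<le> r" "r \<le> l\<^sup>2 + 1" by linarith+
  have "1 \<le> \<lfloor>q\<rfloor>" using q by simp
  then have "real s = of_int \<lfloor>q\<rfloor>" "0 < s" by (simp_all add: s_def)
  then have s: "s \<le> q" "q \<le> 2 * real s" "0 < s" using \<open>1 \<le> \<lfloor>q\<rfloor>\<close> by linarith+
  have "real s \<le> real r" using s q r by linarith
  then have sr: "s \<le> r" by simp
  have cf: "clique_free E r ?V"
    unfolding clique_free_def
  proof (intro allI impI notI)
    fix Q assume Q: "Q \<subseteq> ?V" "finite Q" "pairwise E Q" "card Q = r"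
    have "Q \<noteq> {}" using Q(4) s sr by auto
    have "1 \<le> real r * (1 / l\<^sup>2)" using r l by (simp add: field_simps)
    also have "\<dots> = (\<Sum>i\<in>Q. 1 / l\<^sup>2)" using Q by simp
    also have "\<dots> < (\<Sum>i\<in>Q. Y i i)" using Q \<open>Q \<noteq> {}\<close> by (intro sum_strict_mono) auto
    also have "\<dots> \<le> 1" using Q by (intro clique_sum_le) auto
    finally show False by simp
  qed
  have deg: "(4 * r) ^ (20 * s ^ 2) \<le> d"
  proof -
    have "real (4 * r) \<le> l ^ 3" using r l(3) by simp
    also have "l ^ 3 = exp (3 * ln l)" using l by (simp add: exp_of_nat_mult[of 3 "ln l", simplified])
    finally have "real (4 * r) ^ (20 * s ^ 2) \<le> exp (3 * ln l) ^ (20 * s ^ 2)"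
      by (intro power_mono) auto
    also have "\<dots> = exp (60 * ln l * s ^ 2)" by (subst exp_of_nat_mult[symmetric]) (simp add: mult_ac)
    also have "\<dots> \<le> exp l"
    proof -
      have "60 * ln l * s ^ 2 \<le> 60 * ln l * q\<^sup>2"
        using s l by (intro mult_left_mono power_mono) auto
      also have "q\<^sup>2 = l / (60 * ln l)" using l by (simp add: q_def)
      also have "60 * ln l * (l / (60 * ln l)) = l"
      proof -
        have "60 * ln l \<noteq> 0" using l by linarith
        then show ?thesis by (metis times_divide_eq_right nonzero_mult_div_cancel_left)
      qed
      finally show ?thesis by simp
    qed
    also have "\<dots> = d" using d by (simp add: l_def)
    finally show ?thesis by (simp only: of_nat_power[symmetric] of_nat_le_iff)
  qed
  have "s * card ?V \<le> 4 * d * alpha n E"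
  proof (rule stable_set_clique_free[OF _ symE irrE cf s(3) sr deg])
    show "card {w\<in>?V. E v w} \<le> d" if "v \<in> ?V" for v
      using that by (intro degree_within) auto
    show "card I \<le> alpha n E" if "I \<in> stable_sets E ?V" for I
      by (rule card_le_alpha[OF that]) auto
  qed simp
  then have "real (s * card ?V) \<le> real (4 * d * alpha n E)" by (simp only: of_nat_le_iff)
  moreover have "card ?V * q \<le> card ?V * (2 * real s)" using s by (intro mult_left_mono) auto
  ultimately show ?thesis by (simp add: mult_ac)
qed

text \<open>The numerical hypotheses hold for all large \<open>d\<close>. The constants of the three
  classes are 2, 192 and 1: the first from n <= 2 d alpha, the second as 3 * 8 * 8 from
  \<open>?b = 3 * g\<close>, from \<open>card_middle\<close> and from 1/q = sqrt (60 g) <= 8 sqrt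
  g.\<close>

lemma value_le:
  defines "l \<equiv> ln (real d)"
  defines "g \<equiv> ln l / l"
  assumes l: "1 \<le> l" "1 \<le> ln l" "4 * (l\<^sup>2 + 1) \<le> l ^ 3"
    and q: "1 \<le> sqrt (l / (60 * ln l))" "sqrt (l / (60 * ln l)) \<le> l\<^sup>2"
    and b: "1 \<le> 2 * l * (1 - 3 * ln l / l)"
    and big: "l * sqrt l \<le> l ^ 3 / (13 * sqrt (2 * l)) - 1"
  shows "(\<Sum>i=1..n. Y 0 i) \<le> 200 * (g * sqrt g) * (real d * alpha n E)"
proof -
  let ?A = "real d * alpha n E"
  let ?b = "3 * ln l / l"
  let ?S = "{i\<in>{1..n}. Y i i \<le> 1 / l\<^sup>2}"
  let ?M = "{i\<in>{1..n}. 1 / l\<^sup>2 < Y i i \<and> Y i i \<le> ?b}"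
  let ?L = "{i\<in>{1..n}. ?b < Y i i}"
  have d1: "1 \<le> d" using l(1) by (cases "d = 0") (auto simp: l_def)
  have l0: "0 < l" using l by simp
  have g0: "1 / l \<le> g" "0 < g"
  proof -
    show "1 / l \<le> g" unfolding g_def using l by (intro divide_right_mono) auto
    then show "0 < g" using l0 by (meson divide_pos_pos less_le_trans zero_less_one)
  qed
  \<comment> \<open>Since \<open>g >= 1 / l\<close>, the small and large classes need only reach
    l^(-3/2), without any double logarithm.\<close>
  have G1: "1 / (l * sqrt l) \<le> g * sqrt g"
  proof -
    have "1 / (l * sqrt l) = (1 / l) * sqrt (1 / l)" by (simp add: real_sqrt_divide)
    also have "\<dots> \<le> g * sqrt g" using g0 l0 by (intro mult_mono real_sqrt_le_mono) auto
    finally show ?thesis .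
  qed
  have n2: "real n \<le> 2 * ?A"
  proof -
    have "n \<le> (d + 1) * alpha n E" by (rule vertices_le_degree_mult_alpha[OF graph max_deg])
    also have "\<dots> \<le> (2 * d) * alpha n E" using d1 by (intro mult_le_mono1) simp
    finally have "real n \<le> real ((2 * d) * alpha n E)" by (simp only: of_nat_le_iff)
    then show ?thesis by simp
  qed
  have S: "(\<Sum>i\<in>?S. Y i i) \<le> 2 * (g * sqrt g) * ?A"
  proof -
    have "(\<Sum>i\<in>?S. Y i i) \<le> (\<Sum>i\<in>?S. 1 / l\<^sup>2)" by (intro sum_mono) auto
    also have "\<dots> = real (card ?S) * (1 / l\<^sup>2)" by simp
    also have "\<dots> \<le> real n * (g * sqrt g)"
    proof (intro mult_mono)
      have "card ?S \<le> card {1..n}" by (intro card_mono) auto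
      then show "real (card ?S) \<le> real n" by simp
      have "sqrt l \<le> l" using l by (simp add: real_le_lsqrt self_le_power)
      then have "l * sqrt l \<le> l\<^sup>2" unfolding power2_eq_square using l0 by (intro mult_left_mono) auto
      then have "1 / l\<^sup>2 \<le> 1 / (l * sqrt l)" using l0 by (intro divide_left_mono) auto
      then show "1 / l\<^sup>2 \<le> g * sqrt g" using G1 by simp
    qed auto
    also have "\<dots> \<le> 2 * ?A * (g * sqrt g)" using n2 g0 by (intro mult_right_mono) auto
    finally show ?thesis by (simp add: mult_ac)
  qed
  have L: "(\<Sum>i\<in>?L. Y i i) \<le> (g * sqrt g) * ?A"
  proof -
    have "(\<Sum>i\<in>?L. Y i i) \<le> (\<Sum>i\<in>?L. 1)" by (intro sum_mono diag_le_1) auto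
    also have "\<dots> = real (card ?L)" by simp
    also have "\<dots> \<le> ?A * (1 / (l * sqrt l))"
    proof -
      have "real (card ?L) * (l * sqrt l) \<le> real (card ?L) * (l ^ 3 / (13 * sqrt (2 * l)) - 1)"
        using big by (intro mult_left_mono) auto
      also have "\<dots> \<le> ?A"
        using card_large[of ?b] l b l0 unfolding l_def by simp
      finally show ?thesis using l0 by (simp add: field_simps)
    qed
    also have "\<dots> \<le> ?A * (g * sqrt g)" using G1 by (intro mult_left_mono) auto
    finally show ?thesis by (simp add: mult_ac)
  qed
  have M: "(\<Sum>i\<in>?M. Y i i) \<le> 192 * (g * sqrt g) * ?A"
  proof -
    define q where "q = sqrt (l / (60 * ln l))"
    have q0: "0 < q" using q by (simp add: q_def)
    have qM: "real (card ?M) * q \<le> 8 * ?A"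
      using card_middle[of ?b] l q unfolding l_def q_def by (simp add: mult.assoc)
    have "1 / q = sqrt (60 * g)" unfolding q_def g_def by (simp add: real_sqrt_divide)
    also have "\<dots> \<le> sqrt (8\<^sup>2 * g)" using g0 by (intro real_sqrt_le_mono) simp
    also have "\<dots> = 8 * sqrt g" by (simp only: real_sqrt_mult real_sqrt_abs abs_numeral)
    finally have q8: "1 / q \<le> 8 * sqrt g" .
    have "(\<Sum>i\<in>?M. Y i i) \<le> (\<Sum>i\<in>?M. 3 * g)" by (intro sum_mono) (auto simp: g_def)
    also have "\<dots> = 3 * g * real (card ?M)" by simp
    also have "\<dots> \<le> 3 * g * (8 * ?A * (1 / q))"
      using qM q0 g0 by (intro mult_left_mono) (auto simp: field_simps)
    also have "\<dots> \<le> 3 * g * (8 * ?A * (8 * sqrt g))"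
      using q8 g0 by (intro mult_left_mono) auto
    finally show ?thesis by (simp add: mult_ac)
  qed
  have le_b: "1 / l\<^sup>2 \<le> ?b"
  proof -
    have "1 / l\<^sup>2 \<le> 1 / l" using l by (intro divide_left_mono) (auto simp: power2_eq_square)
    also have "\<dots> \<le> ?b" using l by (simp add: divide_right_mono)
    finally show ?thesis .
  qed
  have "(\<Sum>i=1..n. Y 0 i) = (\<Sum>i\<in>{1..n}. Y i i)" by (intro sum.cong Y0) auto
  also have "\<dots> = (\<Sum>i\<in>?S \<union> (?M \<union> ?L). Y i i)" using le_b by (intro sum.cong) auto
  also have "(\<Sum>i\<in>?S \<union> (?M \<union> ?L). Y i i) = (\<Sum>i\<in>?S. Y i i) + (\<Sum>i\<in>?M \<union> ?L. Y i i)"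
    using le_b by (intro sum.union_disjoint) auto
  also have "(\<Sum>i\<in>?M \<union> ?L. Y i i) = (\<Sum>i\<in>?M. Y i i) + (\<Sum>i\<in>?L. Y i i)"
    by (intro sum.union_disjoint) auto
  finally have "(\<Sum>i=1..n. Y 0 i) \<le> 195 * (g * sqrt g) * ?A" using S M L by simp
  also have "\<dots> \<le> 200 * (g * sqrt g) * ?A" using g0 by (intro mult_right_mono) auto
  finally show ?thesis .
qed

text \<open>Serves the finitely many degrees below the asymptotic threshold.\<close>

lemma value_le_trivial:
  assumes "1 \<le> d"
  shows "(\<Sum>i=1..n. Y 0 i) \<le> 2 * real d * alpha n E"
proof -
  have "(\<Sum>i=1..n. Y 0 i) \<le> (\<Sum>i=1..n. 1)"
    using Y0 diag_le_1 by (intro sum_mono) auto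
  also have "\<dots> = real n" by simp
  also have "n \<le> (d + 1) * alpha n E" by (rule vertices_le_degree_mult_alpha[OF graph max_deg])
  also have "\<dots> \<le> (2 * d) * alpha n E" using assms by (intro mult_le_mono1) simp
  finally show ?thesis by simp
qed

end

text \<open>A bound on a supremum of reals needs a nonempty set; the witness is the Gram matrix of a
  unit vector v_0 with all other vectors zero.\<close>

lemma theta_sdp_le:
  assumes "\<And>Y. sdp_feasible n E Y \<Longrightarrow> (\<Sum>i=1..n. Y 0 i) \<le> c"
  shows "theta_sdp n E \<le> c"
  unfolding theta_sdp_def
proof (rule cSup_least)
  let ?Y = "\<lambda>i j. if i = 0 \<and> j = 0 then 1 else (0::real)"
  have "(\<Sum>i=0..n. \<Sum>j=0..n. x i * ?Y i j * x j) = (x 0)\<^sup>2" for x :: "nat \<Rightarrow> real"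
  proof -
    have "(\<Sum>i=0..n. \<Sum>j=0..n. x i * ?Y i j * x j) = (\<Sum>i=0..n. \<Sum>j=0..n. if j = 0 then if i = 0 then (x 0)\<^sup>2 else 0 else 0)"
      by (intro sum.cong) (auto simp: power2_eq_square)
    then show ?thesis by simp
  qed
  then have "sdp_feasible n E ?Y" by (simp add: sdp_feasible_def)
  then show "{(\<Sum>i=1..n. Y 0 i) | Y. sdp_feasible n E Y} \<noteq> {}" by blast
qed (use assms in auto)

theorem theorem1:
  shows "\<exists>C::real. C > 0 \<and>
    (\<forall>(d::nat) (n::nat) (E::nat \<Rightarrow> nat \<Rightarrow> bool).
       d \<ge> 3 \<longrightarrow> simple_graph n E \<longrightarrow> max_degree_le n E d \<longrightarrow>
       theta_sdp n E \<le> C * real d * (log 2 (log 2 (real d)) / log 2 (real d)) powr (3/2)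
                          * real (alpha n E))"
proof -
  define f where "f = (\<lambda>d::nat. (log 2 (log 2 (real d)) / log 2 (real d)) powr (3/2))"
  have "eventually (\<lambda>l::real. 1 \<le> l \<and> 1 \<le> ln l \<and> 4 * (l\<^sup>2 + 1) \<le> l ^ 3 \<and> 1 \<le> sqrt (l / (60 * ln l)) \<and>
      sqrt (l / (60 * ln l)) \<le> l\<^sup>2 \<and> 1 \<le> 2 * l * (1 - 3 * ln l / l) \<and>
      l * sqrt l \<le> l ^ 3 / (13 * sqrt (2 * l)) - 1) at_top"
    by (intro eventually_conj; real_asymp)
  moreover have "filterlim (\<lambda>d::nat. ln (real d)) at_top sequentially" by real_asymp
  ultimately have "eventually (\<lambda>d::nat. 1 \<le> ln (real d) \<and> 1 \<le> ln (ln (real d)) \<and>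
      4 * ((ln (real d))\<^sup>2 + 1) \<le> ln (real d) ^ 3 \<and> 1 \<le> sqrt (ln (real d) / (60 * ln (ln (real d)))) \<and>
      sqrt (ln (real d) / (60 * ln (ln (real d)))) \<le> (ln (real d))\<^sup>2 \<and>
      1 \<le> 2 * ln (real d) * (1 - 3 * ln (ln (real d)) / ln (real d)) \<and>
      ln (real d) * sqrt (ln (real d)) \<le> ln (real d) ^ 3 / (13 * sqrt (2 * ln (real d))) - 1) sequentially"
    by (rule eventually_compose_filterlim)
  then obtain D where D: "\<And>d. d \<ge> D \<Longrightarrow> 1 \<le> ln (real d) \<and> 1 \<le> ln (ln (real d)) \<and>
      4 * ((ln (real d))\<^sup>2 + 1) \<le> ln (real d) ^ 3 \<and> 1 \<le> sqrt (ln (real d) / (60 * ln (ln (real d)))) \<and>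
      sqrt (ln (real d) / (60 * ln (ln (real d)))) \<le> (ln (real d))\<^sup>2 \<and>
      1 \<le> 2 * ln (real d) * (1 - 3 * ln (ln (real d)) / ln (real d)) \<and>
      ln (real d) * sqrt (ln (real d)) \<le> ln (real d) ^ 3 / (13 * sqrt (2 * ln (real d))) - 1"
    unfolding eventually_sequentially by blast
  \<comment> \<open>This is where \<open>d >= 3\<close> enters: at d = 2 the iterated logarithm is
    0, and so is the claimed ratio.\<close>
  have loglog: "0 < log 2 (log 2 (real d))" "0 < log 2 (real d)" if "3 \<le> d" for d
  proof -
    have "log 2 2 < log 2 (real d)" using that by (subst log_less_cancel_iff) auto
    then have "1 < log 2 (real d)" by simp
    then show "0 < log 2 (real d)" by linarith
    show "0 < log 2 (log 2 (real d))"
      by (rule zero_less_log_cancel_iff[THEN iffD2]) (use \<open>1 < log 2 (real d)\<close> in linarith)+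
  qed
  have fpos: "0 < f d" if "3 \<le> d" for d
    unfolding f_def using divide_pos_pos[OF loglog[OF that]] by (metis powr_gt_zero less_irrefl)
  \<comment> \<open>Change of base: the outer logarithms cancel in the quotient, and the inner one
    only grows, because ln d <= log_2 d.\<close>
  have f_ge: "ln (ln (real d)) / ln (real d) * sqrt (ln (ln (real d)) / ln (real d)) \<le> f d"
    if d: "3 \<le> d" and pos: "1 \<le> ln (ln (real d))" "1 \<le> ln (real d)" for d
  proof -
    let ?g = "ln (ln (real d)) / ln (real d)"
    have g0: "0 < ?g" by (rule divide_pos_pos) (use pos in linarith)+
    have "ln 2 < (1::real)" using ln_2_less_1 by simp
    have "ln (real d) = ln 2 * log 2 (real d)" by (simp add: log_def)
    also have "\<dots> \<le> log 2 (real d)" using loglog(2)[OF d] \<open>ln 2 < 1\<close> by simp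
    finally have "ln (ln (real d)) \<le> ln (log 2 (real d))" using pos by (intro ln_mono) auto
    then have "?g \<le> ln (log 2 (real d)) / ln (real d)" using pos by (intro divide_right_mono) auto
    also have "\<dots> = log 2 (log 2 (real d)) / log 2 (real d)" by (simp add: log_def)
    finally have le: "?g \<le> log 2 (log 2 (real d)) / log 2 (real d)" .
    have "?g * sqrt ?g = ?g powr (1 + 1/2)"
      using g0 by (simp only: powr_add powr_half_sqrt powr_one less_imp_le)
    also have "\<dots> = ?g powr (3/2)" by simp
    also have "\<dots> \<le> f d" unfolding f_def using le g0 by (intro powr_mono2) auto
    finally show ?thesis .
  qed
  \<comment> \<open>Below the threshold \<open>D\<close> the ratio takes finitely many positive
    values, so a constant of order 1/m works there; the \<open>+ 3\<close> keeps the range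
    nonempty.\<close>
  define m where "m = Min (f ` {3..D + 3})"
  have m: "0 < m" "\<And>d. 3 \<le> d \<Longrightarrow> d \<le> D + 3 \<Longrightarrow> m \<le> f d"
    unfolding m_def using fpos by (auto intro: Min_le)
  define C where "C = 200 + 2 / m"
  have C: "0 < C" "200 \<le> C" "2 / m \<le> C" using m by (auto simp: C_def add_pos_pos)
  have "theta_sdp n E \<le> C * real d * f d * real (alpha n E)"
    if d: "3 \<le> d" and g: "simple_graph n E" "max_degree_le n E d" for d n E
  proof (rule theta_sdp_le)
    fix Y assume "sdp_feasible n E Y"
    with g interpret theta_solution n d E Y by unfold_locales
    let ?A = "real d * real (alpha n E)"
    show "(\<Sum>i=1..n. Y 0 i) \<le> C * real d * f d * real (alpha n E)"
    proof (cases "D \<le> d")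
      case True
      note D' = D[OF True]
      let ?g = "ln (ln (real d)) / ln (real d)"
      have "(\<Sum>i=1..n. Y 0 i) \<le> 200 * (?g * sqrt ?g) * ?A"
        using D' by (intro value_le) blast+
      also have "\<dots> \<le> C * f d * ?A"
        using C f_ge[OF d] D' fpos[OF d] by (intro mult_right_mono mult_mono) auto
      finally show ?thesis by (simp add: mult_ac)
    next
      case False
      then have "m \<le> f d" using d by (intro m(2)) auto
      then have "2 / m * m \<le> C * f d" using C m fpos[OF d] by (intro mult_mono) auto
      then have "2 \<le> C * f d" using m by simp
      have "(\<Sum>i=1..n. Y 0 i) \<le> 2 * ?A" using value_le_trivial d by (simp add: mult.assoc)
      also have "\<dots> \<le> C * f d * ?A" using \<open>2 \<le> C * f d\<close> by (intro mult_right_mono) auto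
      finally show ?thesis by (simp add: mult_ac)
    qed
  qed
  then show ?thesis using C unfolding f_def by blast
qed

end
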